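(* Assume Bunyakovsky's conjecture for quadratic polynomials (stated in the context). Let $m>1$ be an integer coprime to $30$, and let $\ell$ represent a residue class modulo $m$. Let $C_p$ be a circle of (odd) prime curvature $p$ in a primitive integral Apollonian circle packing, and let $\mathcal{P}^{\mathrm{th}}$ be the thickened prime component containing $C_p$. Then there exists a circle $C_\ell$ at distance two tangencies from $C_p$ in $\mathcal{P}^{\mathrm{th}}$ whose curvature is congruent to $\ell \pmod m$. Furthermore, the two-tangency path can be taken of the following restricted form: there are a Descartes quadruple $\mathbf{v}=(a,b,c,p)$ whose fourth circle is $C_p$, with $\gcd(c+p,m)=1$, and integers $s_0,r_0,t$ such that the path is a $\mathcal{W}$-geodesic from $C_p$ to $C_\ell$ inside the $\mathcal{W}$-family of $\mathbf{v}$, where $\mathcal{W}=W_{43}(s_0)W_{32}(r_0)W_{21}(t)$.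
   Context: An Apollonian circle packing is the set of circles in the plane obtained by starting from four pairwise tangent circles (lines are regarded as circles of curvature $0$) and repeatedly adding, for every triple of pairwise tangent circles already present, the two circles tangent to all three. The curvature is the reciprocal of the radius, taken negative for a circle to which the other circles are internally tangent. The packing is primitive integral if all curvatures are integers with overall gcd $1$. A prime component is a maximal tangency-connected set of circles of the packing all of whose curvatures are odd primes; a thickened prime component is a prime component together with every circle of the packing tangent to some circle of it. The thickened prime component containing $C_p$ is the thickening of the prime component containing $C_p$. A Descartes quadruple is an ordered quadruple of four pairwise tangent circles of the packing, or the quadruple of their curvatures. For $i\in\{1,2,3,4\}$ let $S_i$ be the $4\times4$ matrix that is the identity except that its $i$th row has $-1$ in position $i$ and $2$ elsewhere. Acting on the column vector of curvatures of a Descartes quadruple, $S_i$ replaces the $i$th circle by the other circle tangent to the remaining three. For $s\ge 0$, $W_{ji}(s)=\cdots S_jS_iS_jS_i$ is the alternating product with $s$ letters, the rightmost being $S_i$; for negative arguments $W_{ji}(-s)=W_{ij}(s)$. Given a word $\mathcal{W}$ that is a concatenation of such alternating products and a Descartes quadruple $\mathbf{v}_0=\mathbf{v}$, set $\mathbf{v}_i^T=S_*\mathbf{v}_{i-1}^T$, where $S_*$ runs over the letters of $\mathcal{W}$ from right to left. The $\mathcal{W}$-family of $\mathbf{v}$ is the finite set of circles appearing in the quadruples $\mathbf{v}_0,\mathbf{v}_1,\dots$ so obtained. A $\mathcal{W}$-geodesic from a circle $C$ of $\mathbf{v}$ to a circle $C'$ of the $\mathcal{W}$-family is a minimal-length sequence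 of successively tangent circles in the $\mathcal{W}$-family connecting $C$ to $C'$. Bunyakovsky's conjecture (quadratic case): if $f(x)\in\mathbb{Z}[x]$ is a quadratic polynomial with positive leading coefficient, irreducible, and such that $f(1),f(2),f(3),\dots$ have no common factor, then $f(n)$ is prime for infinitely many positive integers $n$. *)

theory Defs
  imports
    "HOL-Analysis.Analysis"
    "HOL-Computational_Algebra.Computational_Algebra"
    "HOL-Number_Theory.Cong"
begin

text \<open>
  The circles of a packing have pairwise disjoint interiors once each circle is given the
  right side as its interior: the unbounded side for a circle to which the others are
  internally tangent, the side away from the others for a line. A circle is therefore
  represented together with its interior. The sign of the radius \<open>r\<close> in \<open>Circle z r\<close> says which
  side is meant, and \<open>Line n d\<close> is the line of all \<open>w\<close> with \<open>n \<bullet> w = d\<close>, with interior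
  \<open>n \<bullet> w > d\<close>. Under the nondegeneracy condition \<open>is_circle\<close> the parameters are determined
  by the interior, so that equality of circles is equality of values.
\<close>

datatype circle = Circle complex real | is_line: Line complex real

fun is_circle :: "circle \<Rightarrow> bool" where
  "is_circle (Circle z r) \<longleftrightarrow> r \<noteq> 0"
| "is_circle (Line n d) \<longleftrightarrow> norm n = 1"

fun curve :: "circle \<Rightarrow> complex set" where
  "curve (Circle z r) = sphere z \<bar>r\<bar>"
| "curve (Line n d) = {w. n \<bullet> w = d}"

fun inner_side :: "circle \<Rightarrow> complex set" where
  "inner_side (Circle z r) = (if r > 0 then ball z r else - cball z \<bar>r\<bar>)"
| "inner_side (Line n d) = {w. n \<bullet> w > d}"

fun curvature :: "circle \<Rightarrow> real" where
  "curvature (Circle z r) = 1 / r"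
| "curvature (Line n d) = 0"

text \<open>
  Disjointness of the interiors fixes the orientations, and it excludes three circles touching
  each other in one common point. The second alternative covers parallel lines, which touch
  at infinity.
\<close>

definition tangent :: "circle \<Rightarrow> circle \<Rightarrow> bool" where
  "tangent C D \<longleftrightarrow> is_circle C \<and> is_circle D \<and> inner_side C \<inter> inner_side D = {} \<and>
     ((\<exists>!w. w \<in> curve C \<inter> curve D) \<or> is_line C \<and> is_line D \<and> curve C \<inter> curve D = {})"

definition pairwise_tangent :: "circle ^ 4 \<Rightarrow> bool" where
  "pairwise_tangent v \<longleftrightarrow> (\<forall>i j. i \<noteq> j \<longrightarrow> tangent (v $ i) (v $ j))"

inductive_set packing_from :: "circle ^ 4 \<Rightarrow> circle set" for v where
  start: "v $ i \<in> packing_from v"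
| add: "A \<in> packing_from v \<Longrightarrow> B \<in> packing_from v \<Longrightarrow> C \<in> packing_from v \<Longrightarrow>
    tangent A B \<Longrightarrow> tangent B C \<Longrightarrow> tangent A C \<Longrightarrow>
    tangent D A \<Longrightarrow> tangent D B \<Longrightarrow> tangent D C \<Longrightarrow> D \<in> packing_from v"

definition apollonian_packing :: "circle set \<Rightarrow> bool" where
  "apollonian_packing P \<longleftrightarrow> (\<exists>v. pairwise_tangent v \<and> P = packing_from v)"

definition primitive_integral :: "circle set \<Rightarrow> bool" where
  "primitive_integral P \<longleftrightarrow> (\<forall>C\<in>P. curvature C \<in> \<int>) \<and>
     Gcd {k :: int. \<exists>C\<in>P. curvature C = of_int k} = 1"

definition tangency_path :: "circle set \<Rightarrow> circle \<Rightarrow> circle \<Rightarrow> circle list \<Rightarrow> bool" where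
  "tangency_path X C D cs \<longleftrightarrow> cs \<noteq> [] \<and> hd cs = C \<and> last cs = D \<and> set cs \<subseteq> X \<and>
     successively tangent cs"

definition tangency_geodesic :: "circle set \<Rightarrow> circle \<Rightarrow> circle \<Rightarrow> circle list \<Rightarrow> bool" where
  "tangency_geodesic X C D cs \<longleftrightarrow> tangency_path X C D cs \<and>
     (\<forall>ds. tangency_path X C D ds \<longrightarrow> length cs \<le> length ds)"

definition at_tangency_distance :: "circle set \<Rightarrow> nat \<Rightarrow> circle \<Rightarrow> circle \<Rightarrow> bool" where
  "at_tangency_distance X k C D \<longleftrightarrow> (\<exists>cs. tangency_geodesic X C D cs \<and> length cs = k + 1)"

definition tangency_connected :: "circle set \<Rightarrow> bool" where
  "tangency_connected X \<longleftrightarrow> (\<forall>C\<in>X. \<forall>D\<in>X. \<exists>cs. tangency_path X C D cs)"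

definition odd_prime_circles :: "circle set \<Rightarrow> circle set" where
  "odd_prime_circles P = {C \<in> P. \<exists>q :: int. prime q \<and> odd q \<and> curvature C = of_int q}"

definition prime_component :: "circle set \<Rightarrow> circle set \<Rightarrow> bool" where
  "prime_component P X \<longleftrightarrow> X \<subseteq> odd_prime_circles P \<and> tangency_connected X \<and>
     (\<forall>Y. X \<subseteq> Y \<and> Y \<subseteq> odd_prime_circles P \<and> tangency_connected Y \<longrightarrow> Y = X)"

definition thickening :: "circle set \<Rightarrow> circle set \<Rightarrow> circle set" where
  "thickening P X = X \<union> {D \<in> P. \<exists>C\<in>X. tangent D C}"

definition descartes_quadruple :: "circle set \<Rightarrow> circle ^ 4 \<Rightarrow> bool" where
  "descartes_quadruple P v \<longleftrightarrow> pairwise_tangent v \<and> (\<forall>i. v $ i \<in> P)"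

text \<open>
  The numeral \<open>4 :: 4\<close> is the element \<open>0\<close>, hence the entries of a quadruple are indexed by
  \<open>1, 2, 3, 4\<close> as usual.
\<close>

definition swap :: "4 \<Rightarrow> circle ^ 4 \<Rightarrow> circle ^ 4" where
  "swap i v = (\<chi> j. if j = i
     then (THE C. C \<noteq> v $ i \<and> (\<forall>k. k \<noteq> i \<longrightarrow> tangent C (v $ k))) else v $ j)"

text \<open>
  A word is the list of the indices of its letters in the order in which the product is written,
  so that the last entry acts first.
\<close>

fun alternating_word :: "4 \<Rightarrow> 4 \<Rightarrow> nat \<Rightarrow> 4 list" where
  "alternating_word j i 0 = []"
| "alternating_word j i (Suc s) = alternating_word i j s @ [i]"

definition W :: "4 \<Rightarrow> 4 \<Rightarrow> int \<Rightarrow> 4 list" where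
  "W j i s = (if s \<ge> 0 then alternating_word j i (nat s) else alternating_word i j (nat (- s)))"

fun word_quadruple :: "4 list \<Rightarrow> circle ^ 4 \<Rightarrow> nat \<Rightarrow> circle ^ 4" where
  "word_quadruple w v 0 = v"
| "word_quadruple w v (Suc k) = swap (rev w ! k) (word_quadruple w v k)"

definition word_family :: "4 list \<Rightarrow> circle ^ 4 \<Rightarrow> circle set" where
  "word_family w v = {word_quadruple w v k $ i | k i. k \<le> length w}"

definition word_geodesic :: "4 list \<Rightarrow> circle ^ 4 \<Rightarrow> circle \<Rightarrow> circle \<Rightarrow> circle list \<Rightarrow> bool" where
  "word_geodesic w v C D cs \<longleftrightarrow> (\<exists>i. v $ i = C) \<and> tangency_geodesic (word_family w v) C D cs"

definition quadratic_bunyakovsky :: bool where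
  "quadratic_bunyakovsky \<longleftrightarrow> (\<forall>f :: int poly.
     degree f = 2 \<and> lead_coeff f > 0 \<and> irreducible f \<and>
     Gcd ((\<lambda>n :: nat. poly f (int n)) ` {1..}) = 1 \<longrightarrow>
     infinite {n :: nat. n > 0 \<and> prime (poly f (int n))})"

text \<open>
  Inversive coordinates: the curvature, the curvature of the image under inversion in the unit
  circle, and the product of curvature and center (for a line, the unit normal). Tangency of
  compatibly oriented circles means that their inversive product is \<open>- 1\<close>.
\<close>

fun cocurvature :: "circle \<Rightarrow> real" where
  "cocurvature (Circle z r) = (z \<bullet> z - r\<^sup>2) / r"
| "cocurvature (Line n d) = 2 * d"

fun curvature_center :: "circle \<Rightarrow> complex" where
  "curvature_center (Circle z r) = z /\<^sub>R r"
| "curvature_center (Line n d) = n"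

definition ip :: "circle \<Rightarrow> circle \<Rightarrow> real" where
  "ip C D = curvature_center C \<bullet> curvature_center D
     - (curvature C * cocurvature D + cocurvature C * curvature D) / 2"

definition future :: "circle \<Rightarrow> circle \<Rightarrow> bool" where
  "future C D \<longleftrightarrow> curvature C + curvature D > 0
     \<or> curvature C = 0 \<and> curvature D = 0 \<and> cocurvature C + cocurvature D > 0"

lemma ip_sym: "ip C D = ip D C"
  by (simp add: ip_def inner_commute)

lemma future_sym: "future C D = future D C"
  by (auto simp: future_def add.commute)

lemma ip_Circle: "r \<noteq> 0 \<Longrightarrow> s \<noteq> 0 \<Longrightarrow>
   ip (Circle z r) (Circle y s) = (r\<^sup>2 + s\<^sup>2 - (dist z y)\<^sup>2) / (2 * r * s)"
proof -
  assume rs: "r \<noteq> 0" "s \<noteq> 0"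
  have d2: "(dist z y)\<^sup>2 = z \<bullet> z - 2 * (z \<bullet> y) + y \<bullet> y"
    by (simp add: dist_norm power2_norm_eq_inner inner_diff inner_commute)
  show ?thesis unfolding d2 using rs by (simp add: ip_def field_simps power2_eq_square)
qed

lemma ip_Circle_Line: "r \<noteq> 0 \<Longrightarrow> ip (Circle z r) (Line n d) = (z \<bullet> n - d) / r"
  by (simp add: ip_def field_simps)

lemma ip_self: "is_circle C \<Longrightarrow> ip C C = 1"
proof (cases C)
  fix z r assume "is_circle C" "C = Circle z r"
  then show ?thesis by (simp add: ip_Circle power2_eq_square)
next
  fix n d assume "is_circle C" "C = Line n d"
  then show ?thesis by (simp add: ip_def norm_eq_1)
qed

lemma tangent_sym: "tangent C D \<Longrightarrow> tangent D C"
  unfolding tangent_def by (auto simp: Int_commute)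

lemma both_exterior: "\<exists>w. w \<in> - cball z r \<and> w \<in> - cball y s" for z y :: complex
proof -
  have "bounded (cball z r \<union> cball y s)" by simp
  then have "cball z r \<union> cball y s \<noteq> UNIV" using not_bounded_UNIV by metis
  then show ?thesis by blast
qed

lemma exterior_halfplane: "norm n = 1 \<Longrightarrow> \<exists>w. w \<in> - cball z r \<and> n \<bullet> w > d" for z :: complex
proof -
  assume n: "norm n = 1"
  let ?R = "\<bar>r\<bar> + \<bar>d - n \<bullet> z\<bar> + 1"
  have "n \<bullet> n = 1" using n by (simp add: norm_eq_1)
  then have "n \<bullet> (z + ?R *\<^sub>R n) > d" by (simp add: inner_add_right)
  moreover have "dist z (z + ?R *\<^sub>R n) > r" using n by (simp add: dist_norm)
  ultimately show ?thesis by (metis ComplI mem_cball linorder_not_less)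
qed

lemma dist_disjoint_balls:
  fixes z y :: complex
  assumes "ball z r \<inter> ball y s = {}" "r > 0" "s > 0"
  shows "dist z y \<ge> r + s"
proof (rule ccontr)
  assume "\<not> ?thesis"
  then have d: "dist z y < r + s" by simp
  define w where "w = z + (r / (r + s)) *\<^sub>R (y - z)"
  have "w - z = (r / (r + s)) *\<^sub>R (y - z)" by (simp add: w_def)
  then have "dist z w = r / (r + s) * dist z y"
    using assms by (metis abs_of_nonneg add_pos_pos dist_commute dist_norm divide_nonneg_pos less_imp_le norm_scaleR)
  also have "\<dots> < r" using mult_strict_left_mono[OF d \<open>r > 0\<close>] assms by (simp add: field_simps)
  finally have 1: "w \<in> ball z r" by simp
  have "y - w = (s / (r + s)) *\<^sub>R (y - z)"
  proof -
    have "(r / (r + s)) + (s / (r + s)) = 1" using assms by (simp flip: add_divide_distrib)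
    then have "y - z = (r / (r + s)) *\<^sub>R (y - z) + (s / (r + s)) *\<^sub>R (y - z)"
      by (metis scaleR_left_distrib scaleR_one)
    then show ?thesis by (simp add: w_def algebra_simps)
  qed
  then have "dist y w = s / (r + s) * dist z y"
    using assms by (metis abs_of_nonneg add_pos_pos dist_commute dist_norm divide_nonneg_pos less_imp_le norm_scaleR)
  also have "\<dots> < s" using mult_strict_left_mono[OF d \<open>s > 0\<close>] assms by (simp add: field_simps)
  finally have 2: "w \<in> ball y s" by simp
  from 1 2 assms show False by blast
qed

lemma tangent_pos_pos:
  assumes "tangent (Circle z r) (Circle y s)" "r > 0" "s > 0"
  shows "dist z y = r + s"
proof -
  have "dist z y \<ge> r + s" using assms by (intro dist_disjoint_balls) (auto simp: tangent_def)
  moreover obtain w where "dist z w = r" "dist y w = s" using assms by (auto simp: tangent_def)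
  then have "dist z y \<le> r + s" by (metis dist_triangle dist_commute)
  ultimately show ?thesis by simp
qed

lemma tangent_pos_neg:
  assumes "tangent (Circle z r) (Circle y s)" "r > 0" "s < 0"
  shows "dist z y = - s - r \<and> r < - s"
proof -
  have "ball z r \<subseteq> cball y (- s)" using assms by (auto simp: tangent_def)
  then have 1: "dist z y + r \<le> - s" using assms by (simp add: ball_subset_cball_iff)
  obtain w where w: "dist z w = r" "dist y w = - s"
    and u: "\<And>w'. dist z w' = r \<Longrightarrow> dist y w' = - s \<Longrightarrow> w' = w"
    using assms by (fastforce simp: tangent_def)
  from w have "- s \<le> dist z y + r" by (metis dist_triangle dist_commute)
  with 1 have eq: "dist z y = - s - r" by simp
  have "r \<noteq> - s"
  proof
    assume "r = - s"
    then have zy: "z = y" using eq by simp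
    have "dist z (z + of_real r) = r" "dist z (z - of_real r) = r" using assms by (auto simp: dist_norm)
    moreover from this have "dist y (z + of_real r) = - s" "dist y (z - of_real r) = - s"
      unfolding zy[symmetric] \<open>r = - s\<close>[symmetric] using \<open>r = - s\<close> by linarith+
    ultimately have "z + of_real r = w" "z - of_real r = w" by (blast intro: u)+
    then have "z + of_real r = z - of_real r" by simp
    then show False using assms by simp
  qed
  then show ?thesis using eq 1 by (smt (verit) zero_le_dist)
qed

lemma tangent_neg_neg: "\<not> (tangent (Circle z r) (Circle y s) \<and> r < 0 \<and> s < 0)"
  using both_exterior[of z "- r" y "- s"] by (auto simp: tangent_def disjoint_iff)

lemma tangent_Circle:
  assumes "tangent (Circle z r) (Circle y s)"
  shows "dist z y = \<bar>r + s\<bar> \<and> 1 / r + 1 / s > 0"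
proof -
  have nz: "r \<noteq> 0" "s \<noteq> 0" using assms by (auto simp: tangent_def)
  consider "r > 0" "s > 0" | "r > 0" "s < 0" | "r < 0" "s > 0" | "r < 0" "s < 0"
    using nz by linarith
  then show ?thesis
  proof cases
    case 1
    then show ?thesis using tangent_pos_pos[OF assms] by (simp add: add_pos_pos)
  next
    case 2
    then have "dist z y = - s - r" "r < - s" using tangent_pos_neg[OF assms] by auto
    moreover have "1 / r + 1 / s = (r + s) / (r * s)" using nz by (simp add: field_simps)
    ultimately show ?thesis using 2 by (simp add: zero_less_divide_iff mult_less_0_iff zero_less_mult_iff)
  next
    case 3
    then have "dist z y = - r - s" "s < - r" using tangent_pos_neg[OF tangent_sym[OF assms]]
      by (auto simp: dist_commute)
    moreover have "1 / r + 1 / s = (r + s) / (r * s)" using nz by (simp add: field_simps)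
    ultimately show ?thesis using 3 by (simp add: zero_less_divide_iff mult_less_0_iff zero_less_mult_iff)
  next
    case 4
    then show ?thesis using tangent_neg_neg assms by blast
  qed
qed

lemma tangent_Circle_Line:
  assumes "tangent (Circle z r) (Line n d)"
  shows "r > 0 \<and> z \<bullet> n = d - r"
proof -
  have n: "norm n = 1" "n \<bullet> n = 1" and nz: "r \<noteq> 0" using assms by (auto simp: tangent_def norm_eq_1)
  have r: "r > 0"
  proof (rule ccontr)
    assume "\<not> r > 0"
    then show False using exterior_halfplane[of n z "\<bar>r\<bar>" d] n assms
      by (auto simp: tangent_def disjoint_iff)
  qed
  obtain w where w: "dist z w = r" "n \<bullet> w = d" using assms r by (auto simp: tangent_def)
  have "(z - w) \<bullet> n \<ge> - r"
    using Cauchy_Schwarz_ineq2[of "z - w" n] w n by (simp add: dist_norm)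
  then have 1: "z \<bullet> n \<ge> d - r" using w by (simp add: inner_diff_right inner_commute[of _ n])
  have "z \<bullet> n \<le> d - r"
  proof (rule ccontr)
    assume big: "\<not> z \<bullet> n \<le> d - r"
    define t where "t = max 0 ((d - z \<bullet> n + r) / 2)"
    have t: "0 \<le> t" "t < r" "z \<bullet> n + t > d" using big r by (auto simp: t_def max_def field_simps)
    have "z + t *\<^sub>R n \<in> ball z r" using t n by (simp add: dist_norm)
    moreover have "n \<bullet> (z + t *\<^sub>R n) > d" using t n by (simp add: inner_add_right inner_commute)
    ultimately show False using assms r by (auto simp: tangent_def disjoint_iff)
  qed
  with 1 r show ?thesis by simp
qed

lemma tangent_Line:
  assumes "tangent (Line n d) (Line m e)"
  shows "m = - n \<and> d + e > 0"
proof -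
  have n: "norm n = 1" "n \<bullet> n = 1" "norm m = 1" "m \<bullet> m = 1"
    using assms by (auto simp: tangent_def norm_eq_1)
  have disj: "\<not> (n \<bullet> w > d \<and> m \<bullet> w > e)" for w using assms by (auto simp: tangent_def disjoint_iff)
  have "n \<bullet> m \<le> - 1"
  proof (rule ccontr)
    assume "\<not> ?thesis"
    then have p: "1 + n \<bullet> m > 0" by simp
    define R where "R = (\<bar>d\<bar> + \<bar>e\<bar> + 1) / (1 + n \<bullet> m)"
    have R: "R * (1 + n \<bullet> m) = \<bar>d\<bar> + \<bar>e\<bar> + 1" using p by (simp add: R_def)
    have "n \<bullet> (R *\<^sub>R (n + m)) = R * (1 + n \<bullet> m)" "m \<bullet> (R *\<^sub>R (n + m)) = R * (1 + n \<bullet> m)"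
      using n by (auto simp: inner_add_right inner_commute)
    with R disj[of "R *\<^sub>R (n + m)"] show False by linarith
  qed
  then have "(n + m) \<bullet> (n + m) \<le> 0" using n by (simp add: inner_add_left inner_add_right inner_commute)
  then have "(n + m) \<bullet> (n + m) = 0" using inner_ge_zero[of "n + m"] by linarith
  then have "n + m = 0" by (simp only: inner_eq_zero_iff)
  then have m: "m = - n" by (simp add: add_eq_0_iff)
  have "curve (Line n d) \<inter> curve (Line m e) = {}"
  proof (rule ccontr)
    assume ne: "\<not> ?thesis"
    with assms obtain w where w: "n \<bullet> w = d" "m \<bullet> w = e"
      and u: "\<And>w'. n \<bullet> w' = d \<Longrightarrow> m \<bullet> w' = e \<Longrightarrow> w' = w"
      by (fastforce simp: tangent_def)
    have "n \<bullet> (w + \<i> * n) = d" using w by (simp add: inner_complex_def algebra_simps)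
    moreover from this w have "m \<bullet> (w + \<i> * n) = e" unfolding m inner_minus_left by linarith
    ultimately have "w + \<i> * n = w" by (rule u)
    with n show False by auto
  qed
  then have "d *\<^sub>R n \<notin> {w. n \<bullet> w = d} \<inter> {w. m \<bullet> w = e}" by simp
  then have "\<not> (n \<bullet> (d *\<^sub>R n) = d \<and> m \<bullet> (d *\<^sub>R n) = e)" by blast
  then have "d + e \<noteq> 0" using m n by simp
  moreover have "\<not> d + e < 0"
  proof
    assume "d + e < 0"
    then show False using disj[of "((d - e) / 2) *\<^sub>R n"] m n by (simp add: field_simps)
  qed
  ultimately show ?thesis using m by linarith
qed

lemma tangent_imp: "tangent C D \<Longrightarrow> is_circle C \<and> is_circle D \<and> ip C D = - 1 \<and> future C D"
proof -
  assume t: "tangent C D"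
  then have v: "is_circle C" "is_circle D" by (auto simp: tangent_def)
  have "ip C D = - 1 \<and> future C D"
  proof (cases C; cases D)
    fix z r y s assume [simp]: "C = Circle z r" "D = Circle y s"
    have "dist z y = \<bar>r + s\<bar>" "1 / r + 1 / s > 0" using tangent_Circle t by auto
    then show ?thesis using v by (simp add: ip_Circle future_def field_simps power2_eq_square)
  next
    fix z r n d assume [simp]: "C = Circle z r" "D = Line n d"
    show ?thesis using tangent_Circle_Line[of z r n d] t by (simp add: ip_Circle_Line future_def)
  next
    fix z r n d assume [simp]: "D = Circle z r" "C = Line n d"
    show ?thesis using tangent_Circle_Line[of z r n d] tangent_sym[OF t]
      by (simp add: ip_Circle_Line future_def ip_sym[of C D, simplified])
  next
    fix n d m e assume [simp]: "C = Line n d" "D = Line m e"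
    show ?thesis using tangent_Line[of n d m e] t v by (simp add: ip_def future_def norm_eq_1)
  qed
  with v show ?thesis by simp
qed

lemma touch_Circle:
  fixes z y :: complex
  assumes "dist z y = \<bar>r + s\<bar>" "r + s \<noteq> 0"
  shows "\<exists>!w. dist z w = \<bar>r\<bar> \<and> dist y w = \<bar>s\<bar>"
proof
  let ?w = "(1 / (r + s)) *\<^sub>R (s *\<^sub>R z + r *\<^sub>R y)"
  have e: "(r + s) *\<^sub>R ?w = s *\<^sub>R z + r *\<^sub>R y" using assms(2) by simp
  have "(r + s) *\<^sub>R (z - ?w) = r *\<^sub>R (z - y)" "(r + s) *\<^sub>R (y - ?w) = s *\<^sub>R (y - z)"
    unfolding scaleR_right_diff_distrib[of "r + s"] e by (simp_all add: algebra_simps)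
  then have "\<bar>r + s\<bar> * norm (z - ?w) = \<bar>r\<bar> * norm (z - y)" "\<bar>r + s\<bar> * norm (y - ?w) = \<bar>s\<bar> * norm (y - z)"
    by (metis norm_scaleR)+
  then show "dist z ?w = \<bar>r\<bar> \<and> dist y ?w = \<bar>s\<bar>"
    using assms by (simp add: dist_norm norm_minus_commute)
  fix w assume w: "dist z w = \<bar>r\<bar> \<and> dist y w = \<bar>s\<bar>"
  have a: "(w - z) \<bullet> (w - z) = r\<^sup>2" "(y - w) \<bullet> (y - w) = s\<^sup>2" 
    using w by (metis dist_commute dist_norm power2_abs power2_norm_eq_inner)+
  have "((w - z) + (y - w)) \<bullet> ((w - z) + (y - w)) = (r + s)\<^sup>2"
    using assms by (metis add_diff_cancel_left' diff_add_cancel diff_add_eq dist_commute dist_norm power2_abs power2_norm_eq_inner add.commute)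
  then have b: "(w - z) \<bullet> (y - w) = r * s"
    unfolding inner_add_left inner_add_right using a
    by (simp add: inner_commute power2_sum)
  have "(s *\<^sub>R (w - z) - r *\<^sub>R (y - w)) \<bullet> (s *\<^sub>R (w - z) - r *\<^sub>R (y - w))
    = s * s * ((w - z) \<bullet> (w - z)) - 2 * r * s * ((w - z) \<bullet> (y - w)) + r * r * ((y - w) \<bullet> (y - w))"
    by (simp only: inner_diff_left[of "s *\<^sub>R _"] inner_diff_right[of _ "s *\<^sub>R _"] inner_scaleR_left inner_scaleR_right)
       (simp add: inner_commute algebra_simps)
  also have "\<dots> = 0" unfolding a b by (simp add: power2_eq_square)
  finally have "s *\<^sub>R (w - z) = r *\<^sub>R (y - w)" by simp
  then have "(r + s) *\<^sub>R w = s *\<^sub>R z + r *\<^sub>R y" by (simp add: algebra_simps)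
  then show "w = ?w" using assms(2) by (metis divide_self_if scaleR_one scaleR_scaleR times_divide_eq_left mult_1)
qed

lemma touch_Circle_Line:
  fixes z n :: complex
  assumes "norm n = 1" "z \<bullet> n = d - r"
  shows "\<exists>!w. dist z w = \<bar>r\<bar> \<and> n \<bullet> w = d"
proof
  have n: "n \<bullet> n = 1" using assms by (simp add: norm_eq_1)
  show "dist z (z + r *\<^sub>R n) = \<bar>r\<bar> \<and> n \<bullet> (z + r *\<^sub>R n) = d"
    using assms n by (simp add: dist_norm inner_add_right inner_commute)
  fix w assume w: "dist z w = \<bar>r\<bar> \<and> n \<bullet> w = d"
  have a: "(w - z) \<bullet> (w - z) = r\<^sup>2" using w by (metis dist_commute dist_norm power2_abs power2_norm_eq_inner)
  have b: "(w - z) \<bullet> n = r" using w assms by (simp add: inner_diff_right inner_commute[of _ n])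
  have "((w - z) - r *\<^sub>R n) \<bullet> ((w - z) - r *\<^sub>R n) = (w - z) \<bullet> (w - z) - 2 * r * ((w - z) \<bullet> n) + r * r * (n \<bullet> n)"
    by (simp only: inner_diff_left[of "w - z"] inner_diff_right[of _ "w - z"] inner_scaleR_left inner_scaleR_right)
       (simp add: inner_commute algebra_simps)
  also have "\<dots> = 0" unfolding a b n by (simp add: power2_eq_square)
  finally have "(w - z) - r *\<^sub>R n = 0" by simp
  then show "w = z + r *\<^sub>R n" by (simp add: algebra_simps)
qed

lemma tangentI_Circle:
  assumes "r \<noteq> 0" "s \<noteq> 0" "ip (Circle z r) (Circle y s) = - 1" "1 / r + 1 / s > 0"
  shows "tangent (Circle z r) (Circle y s)"
proof -
  have rs: "r + s \<noteq> 0" using assms by (auto simp: add_eq_0_iff)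
  have "(dist z y)\<^sup>2 = (r + s)\<^sup>2"
    using assms(1,2,3) by (simp add: ip_Circle field_simps power2_eq_square)
  then have d: "dist z y = \<bar>r + s\<bar>" by (metis abs_of_nonneg power2_eq_iff_nonneg abs_ge_zero power2_abs zero_le_dist)
  have ex: "\<exists>!w. dist z w = \<bar>r\<bar> \<and> dist y w = \<bar>s\<bar>" using touch_Circle[OF d rs] .
  have disj: "inner_side (Circle z r) \<inter> inner_side (Circle y s) = {}"
  proof -
    have frac: "1 / r + 1 / s = (r + s) / (r * s)" using assms by (simp add: field_simps)
    consider "r > 0" "s > 0" | "r > 0" "s < 0" | "r < 0" "s > 0" | "r < 0" "s < 0"
      using assms(1,2) by linarith
    then show ?thesis
    proof cases
      case 1 then show ?thesis using d disjoint_ballI[of r s z y] by simp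
    next
      case 2
      then have "r < - s" using assms(4) frac by (simp add: zero_less_divide_iff mult_less_0_iff zero_less_mult_iff)
      then have "ball z r \<subseteq> cball y (- s)" using d 2 by (simp add: ball_subset_cball_iff)
      then show ?thesis using 2 by auto
    next
      case 3
      then have "s < - r" using assms(4) frac by (simp add: zero_less_divide_iff mult_less_0_iff zero_less_mult_iff)
      then have "ball y s \<subseteq> cball z (- r)" using d 3 by (simp add: ball_subset_cball_iff dist_commute)
      then show ?thesis using 3 by auto
    next
      case 4
      then have "1 / r < 0" "1 / s < 0" by auto
      then show ?thesis using assms by linarith
    qed
  qed
  show ?thesis unfolding tangent_def using assms ex disj by auto
qed

lemma tangentI_Circle_Line:
  assumes "r > 0" "norm n = 1" "ip (Circle z r) (Line n d) = - 1"
  shows "tangent (Circle z r) (Line n d)"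
proof -
  have e: "z \<bullet> n = d - r" using assms by (simp add: ip_Circle_Line field_simps)
  have "n \<bullet> w \<le> d" if "dist z w < r" for w
  proof -
    have "(w - z) \<bullet> n \<le> r" using Cauchy_Schwarz_ineq2[of "w - z" n] assms that
      by (simp add: dist_norm norm_minus_commute)
    then show ?thesis using e by (simp add: inner_diff_right inner_commute[of _ n])
  qed
  then have "inner_side (Circle z r) \<inter> inner_side (Line n d) = {}" using assms by fastforce
  then show ?thesis unfolding tangent_def using touch_Circle_Line[OF assms(2) e] assms by auto
qed

lemma tangentI_Line:
  assumes "norm n = 1" "norm m = 1" "ip (Line n d) (Line m e) = - 1" "d + e > 0"
  shows "tangent (Line n d) (Line m e)"
proof -
  have "(n + m) \<bullet> (n + m) = 0" using assms
    by (simp add: inner_add_left inner_add_right inner_commute ip_def norm_eq_1)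
  then have m: "m = - n" by (simp add: add_eq_0_iff)
  show ?thesis unfolding tangent_def using assms(1,4) m by auto
qed

lemma tangentI:
  assumes "is_circle C" "is_circle D" "ip C D = - 1" "future C D"
  shows "tangent C D"
proof (cases C; cases D)
  fix z r y s assume "C = Circle z r" "D = Circle y s"
  then show ?thesis using assms tangentI_Circle by (auto simp: future_def)
next
  fix z r n d assume "C = Circle z r" "D = Line n d"
  then show ?thesis using assms tangentI_Circle_Line by (auto simp: future_def)
next
  fix z r n d assume "D = Circle z r" "C = Line n d"
  then show ?thesis using assms tangentI_Circle_Line tangent_sym by (auto simp: future_def ip_sym[of "Line _ _"])
next
  fix n d m e assume "C = Line n d" "D = Line m e"
  then show ?thesis using assms tangentI_Line by (auto simp: future_def)
qed

type_synonym quad = "real \<times> real \<times> complex"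

definition bil :: "quad \<Rightarrow> quad \<Rightarrow> real" where
  "bil u v = snd (snd u) \<bullet> snd (snd v) - (fst u * fst (snd v) + fst (snd u) * fst v) / 2"

definition co :: "circle \<Rightarrow> quad" where
  "co C = (curvature C, cocurvature C, curvature_center C)"

lemma ip_co: "ip C D = bil (co C) (co D)"
  by (simp add: ip_def bil_def co_def)

lemma bil_add: "bil (u + u') v = bil u v + bil u' v" "bil v (u + u') = bil v u + bil v u'"
  by (simp_all add: bil_def inner_add_left inner_add_right field_simps)
lemma bil_diff: "bil (u - u') v = bil u v - bil u' v" "bil v (u - u') = bil v u - bil v u'"
  by (simp_all add: bil_def inner_diff_left inner_diff_right field_simps)
lemma bil_scale: "bil (r *\<^sub>R u) v = r * bil u v" "bil v (r *\<^sub>R u) = r * bil v u"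
  by (simp_all add: bil_def field_simps)
lemmas bil_lin = bil_add bil_diff bil_scale
lemma bil_sym: "bil u v = bil v u"
  by (simp add: bil_def inner_commute)

lemma co_inj:
  assumes "is_circle C" "is_circle D" "co C = co D"
  shows "C = D"
  using assms by (cases C; cases D) (auto simp: co_def field_simps)

lemma co_surj:
  assumes "bil u u = 1"
  shows "\<exists>C. is_circle C \<and> co C = u"
proof -
  obtain k h c where u: "u = (k, h, c)" by (metis prod.collapse)
  have e: "c \<bullet> c - k * h = 1" using assms by (simp add: u bil_def mult.commute)
  show ?thesis
  proof (cases "k = 0")
    case True
    then show ?thesis using e by (intro exI[of _ "Line c (h / 2)"]) (simp add: co_def u norm_eq_1)
  next
    case False
    have cc: "c \<bullet> c = k * h + 1" using e by simp
    have "k * (((1 / k) *\<^sub>R c) \<bullet> ((1 / k) *\<^sub>R c) - (1 / k)\<^sup>2) = h"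
      using False by (simp add: cc field_simps power2_eq_square)
    then show ?thesis using False
      by (intro exI[of _ "Circle ((1 / k) *\<^sub>R c) (1 / k)"]) (simp add: co_def u mult.commute)
  qed
qed

definition fut :: "quad \<Rightarrow> bool" where
  "fut u \<longleftrightarrow> fst u > 0 \<or> fst u = 0 \<and> fst (snd u) > 0"

lemma future_co:
  assumes "ip C D = - 1" "is_circle C" "is_circle D"
  shows "future C D \<longleftrightarrow> fut (co C + co D)"
proof
  show "future C D \<Longrightarrow> fut (co C + co D)" by (auto simp: future_def fut_def co_def)
next
  assume f: "fut (co C + co D)"
  obtain k h c where C: "co C = (k, h, c)" by (metis prod.collapse)
  obtain k' h' c' where D: "co D = (k', h', c')" by (metis prod.collapse)
  have e: "c \<bullet> c - k * h = 1" "c' \<bullet> c' - k' * h' = 1" "c \<bullet> c' - (k * h' + h * k') / 2 = - 1"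
    using assms ip_self[of C] ip_self[of D] by (simp_all add: ip_co bil_def C D mult.commute)
  have "k = 0" if "k + k' = 0" "h + h' > 0"
  proof -
    have k': "k' = - k" using that by simp
    have "(c + c') \<bullet> (c + c') = (k + k') * (h + h')"
      using e by (simp add: inner_add_left inner_add_right inner_commute algebra_simps)
    then have "c + c' = 0" using that by simp
    then have c': "c' = - c" by (simp add: add_eq_0_iff)
    have "k * (h + h') = 0" using e unfolding k' c' by (simp add: algebra_simps)
    then show ?thesis using that by simp
  qed
  then show "future C D" using f C D by (auto simp: future_def fut_def co_def)
qed

lemma fut_imp:
  assumes "bil u u = 0" "bil v v = 0" "fut u" "bil u v < 0"
  shows "fut v"
proof (rule ccontr)
  assume nf: "\<not> fut v"
  obtain k h c where u: "u = (k, h, c)" by (metis prod.collapse)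
  obtain k' h' c' where v: "v = (k', h', c')" by (metis prod.collapse)
  have cc: "c \<bullet> c = k * h" "c' \<bullet> c' = k' * h'" using assms by (simp_all add: bil_def u v)
  then have "k * h \<ge> 0" "k' * h' \<ge> 0" by (metis inner_ge_zero)+
  then have s: "k \<ge> 0" "h \<ge> 0" "k' \<le> 0" "h' \<le> 0"
    using assms(3) nf by (auto simp: fut_def u v zero_le_mult_iff)
  define X Y where "X = k * (- h')" and "Y = h * (- k')"
  have XY: "X \<ge> 0" "Y \<ge> 0" using s by (auto simp: X_def Y_def zero_le_mult_iff mult_le_0_iff)
  have "(c \<bullet> c')\<^sup>2 \<le> X * Y" using Cauchy_Schwarz_ineq[of c c'] cc by (simp add: X_def Y_def mult_ac)
  also have "\<dots> \<le> ((X + Y) / 2)\<^sup>2"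
    using zero_le_power2[of "X - Y"] by (simp add: power2_eq_square field_simps)
  finally have "\<bar>c \<bullet> c'\<bar> \<le> (X + Y) / 2" using XY abs_le_square_iff[of "c \<bullet> c'" "(X + Y) / 2"] by simp
  then have "bil u v \<ge> 0" by (simp add: bil_def u v X_def Y_def field_simps)
  with assms show False by simp
qed

lemma gram_span:
  assumes "bil a a = 1" "bil b b = 1" "bil c c = 1" "bil d d = 1"
    "bil a b = -1" "bil a c = -1" "bil a d = -1" "bil b c = -1" "bil b d = -1" "bil c d = -1"
    and "bil u a = 0" "bil u b = 0" "bil u c = 0" "bil u d = 0"
  shows "u = 0"
proof -
  define f :: "quad \<Rightarrow> quad" where "f = (\<lambda>u. (bil u a, bil u b, Complex (bil u c) (bil u d)))"
  have sy: "bil b a = -1" "bil c a = -1" "bil d a = -1" "bil c b = -1" "bil d b = -1" "bil d c = -1"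
    using assms by (simp_all add: bil_sym)
  have lin: "linear f"
    by (intro linearI) (simp_all add: f_def bil_lin complex_eq_iff)
  have "surj f"
  proof (rule surjI)
    fix y :: quad
    let ?s = "(fst y + fst (snd y) + Re (snd (snd y)) + Im (snd (snd y))) / 4"
    show "f ((fst y / 2 - ?s) *\<^sub>R a + (fst (snd y) / 2 - ?s) *\<^sub>R b
      + (Re (snd (snd y)) / 2 - ?s) *\<^sub>R c + (Im (snd (snd y)) / 2 - ?s) *\<^sub>R d) = y"
      by (auto simp: f_def bil_lin assms sy prod_eq_iff complex_eq_iff field_simps)
  qed
  then have "inj f" using linear_surjective_imp_injective lin by blast
  moreover have "f u = f 0" using assms lin by (simp add: f_def bil_def complex_eq_iff)
  ultimately show ?thesis by (simp add: inj_eq)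
qed

lemma other_vector:
  assumes "bil a a = 1" "bil b b = 1" "bil c c = 1" "bil d d = 1"
    "bil a b = -1" "bil a c = -1" "bil a d = -1" "bil b c = -1" "bil b d = -1" "bil c d = -1"
    and "bil e e = 1" "bil e a = -1" "bil e b = -1" "bil e c = -1"
  shows "e = d \<or> e = 2 *\<^sub>R (a + b + c) - d"
proof -
  have sy: "bil b a = -1" "bil c a = -1" "bil d a = -1" "bil c b = -1" "bil d b = -1" "bil d c = -1"
    "bil a e = -1" "bil b e = -1" "bil c e = -1" "bil d e = bil e d"
    using assms by (simp_all add: bil_sym)
  define t where "t = bil e d"
  define u where "u = ((1 - t) / 4) *\<^sub>R (a + b + c) + ((t + 3) / 4) *\<^sub>R d"
  have "e - u = 0"
    by (rule gram_span[OF assms(1-10)])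
       (simp_all add: u_def bil_lin assms sy t_def field_simps)
  then have e: "e = u" by simp
  have "1 = bil e u" using assms(11) e by simp
  also have "\<dots> = (t * t + 6 * t - 3) / 4" 
    unfolding u_def by (simp add: bil_lin assms t_def[symmetric] field_simps)
  finally have "(t - 1) * (t + 7) = 0" by (simp add: algebra_simps)
  then have "t = 1 \<or> t = - 7" by auto
  then show ?thesis using e by (auto simp: u_def)
qed

lemma other_circle:
  assumes "tangent A B" "tangent A C" "tangent A D" "tangent B C" "tangent B D" "tangent C D"
  shows "\<exists>E. (\<forall>F. F \<noteq> D \<and> tangent F A \<and> tangent F B \<and> tangent F C \<longleftrightarrow> F = E) \<and>
    curvature E = 2 * (curvature A + curvature B + curvature C) - curvature D"
proof -
  note t = tangent_imp[OF assms(1)] tangent_imp[OF assms(2)] tangent_imp[OF assms(3)]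
    tangent_imp[OF assms(4)] tangent_imp[OF assms(5)] tangent_imp[OF assms(6)]
  have valid: "is_circle A" "is_circle B" "is_circle C" "is_circle D" using t by auto
  define a b c d where abcd: "a = co A" "b = co B" "c = co C" "d = co D"
  have g: "bil a a = 1" "bil b b = 1" "bil c c = 1" "bil d d = 1"
    "bil a b = -1" "bil a c = -1" "bil a d = -1" "bil b c = -1" "bil b d = -1" "bil c d = -1"
    using t valid ip_self by (auto simp: abcd ip_co)
  have sy: "bil b a = -1" "bil c a = -1" "bil d a = -1" "bil c b = -1" "bil d b = -1" "bil d c = -1"
    using g by (simp_all add: bil_sym)
  define e where "e = 2 *\<^sub>R (a + b + c) - d"
  have ee: "bil e e = 1" "bil e a = -1" "bil e b = -1" "bil e c = -1" "bil e d = - 7"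
    "bil a e = -1" "bil b e = -1" "bil c e = -1"
    by (simp_all add: e_def bil_lin g sy)
  obtain E where E: "is_circle E" "co E = e" using co_surj[OF ee(1)] by blast
  have fu: "fut (a + b)" "fut (a + c)" "fut (b + c)"
    using t future_co by (auto simp: abcd)
  have fe: "fut (e + a)" "fut (e + b)" "fut (e + c)"
    using fut_imp[of "b + c" "e + a"] fut_imp[of "a + c" "e + b"] fut_imp[of "a + b" "e + c"]
    by (simp_all add: fu bil_lin g sy ee)
  have ipE: "ip E A = -1" "ip E B = -1" "ip E C = -1"
    using E ee by (simp_all add: ip_co abcd)
  have tE: "tangent E A" "tangent E B" "tangent E C"
    using tangentI[OF E(1)] valid ipE future_co[OF ipE(1)] future_co[OF ipE(2)] future_co[OF ipE(3)] E fe
    by (auto simp: abcd)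
  have nE: "E \<noteq> D" using ee(5) g(4) E by (auto simp: abcd)
  have un: "F = E" if F: "F \<noteq> D" "tangent F A" "tangent F B" "tangent F C" for F
  proof -
    have "is_circle F" using F(2) by (simp add: tangent_def)
    have "co F = d \<or> co F = e" unfolding e_def
      using F(2-4)[THEN tangent_imp] ip_self[of F]
      by (intro other_vector[OF g]) (auto simp: abcd ip_co)
    then show ?thesis using co_inj \<open>is_circle F\<close> E valid F(1) by (metis abcd(4))
  qed
  have "curvature E = fst e" using E(2) by (auto simp: co_def)
  also have "\<dots> = 2 * (curvature A + curvature B + curvature C) - curvature D"
    by (simp add: e_def abcd co_def)
  finally show ?thesis using tE nE un by blast
qed

lemma pairwise_tangent_iff: "pairwise_tangent v \<longleftrightarrow> tangent (v $ 1) (v $ 2) \<and> tangent (v $ 1) (v $ 3)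
    \<and> tangent (v $ 1) (v $ 4) \<and> tangent (v $ 2) (v $ 3) \<and> tangent (v $ 2) (v $ 4) \<and> tangent (v $ 3) (v $ 4)"
  unfolding pairwise_tangent_def forall_4 by (auto intro: tangent_sym)

lemma swap_nth:
  assumes v: "pairwise_tangent v"
  shows "swap i v $ i \<noteq> v $ i \<and> (\<forall>k. k \<noteq> i \<longrightarrow> tangent (swap i v $ i) (v $ k)) \<and>
    curvature (swap i v $ i) = 2 * (\<Sum>k\<in>UNIV - {i}. curvature (v $ k)) - curvature (v $ i)"
proof -
  have t: "tangent (v $ j) (v $ k)" if "j \<noteq> k" for j k using v that by (simp add: pairwise_tangent_def)
  obtain A B C where ABC: "UNIV - {i} = {A, B, C}" "A \<noteq> B" "A \<noteq> C" "B \<noteq> C"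
  proof -
    have "card (UNIV - {i} :: 4 set) = 3" by simp
    then show ?thesis using that unfolding card_3_iff by metis
  qed
  then have ni: "k \<noteq> i \<longleftrightarrow> k = A \<or> k = B \<or> k = C" for k by blast
  obtain E where E: "\<And>F. F \<noteq> v $ i \<and> tangent F (v $ A) \<and> tangent F (v $ B) \<and> tangent F (v $ C) \<longleftrightarrow> F = E"
    and c: "curvature E = 2 * (curvature (v $ A) + curvature (v $ B) + curvature (v $ C)) - curvature (v $ i)"
    using other_circle[of "v $ A" "v $ B" "v $ C" "v $ i"] t ABC ni by blast
  have "(\<forall>k. k \<noteq> i \<longrightarrow> tangent F (v $ k)) \<longleftrightarrow> tangent F (v $ A) \<and> tangent F (v $ B) \<and> tangent F (v $ C)" for F
    using ni by auto
  then have P: "F \<noteq> v $ i \<and> (\<forall>k. k \<noteq> i \<longrightarrow> tangent F (v $ k)) \<longleftrightarrow> F = E" for F using E by simp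
  then have "swap i v $ i = E" by (simp add: swap_def)
  then show ?thesis using P[of E] c ABC by simp
qed

lemma swap_other: "j \<noteq> i \<Longrightarrow> swap i v $ j = v $ j"
  by (simp add: swap_def)

lemma pairwise_tangent_swap: "pairwise_tangent v \<Longrightarrow> pairwise_tangent (swap i v)"
  using swap_nth[of v i] unfolding pairwise_tangent_def
  by (metis swap_other tangent_sym)

definition S_matrix :: "4 \<Rightarrow> real ^ 4 ^ 4" where
  "S_matrix i = (\<chi> j k. if j = i then (if k = i then - 1 else 2) else (if j = k then 1 else 0))"

text \<open>
  The replacement of the \<open>i\<close>th circle acts on the curvatures as the matrix \<open>S\<^sub>i\<close>; by \<open>swap_nth\<close> and
  \<open>pairwise_tangent_swap\<close> the circle described in the definition of \<open>swap\<close> exists and the result is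
  again a quadruple of pairwise tangent circles.
\<close>

lemma curvature_swap:
  assumes "pairwise_tangent v"
  shows "(\<chi> j. curvature (swap i v $ j)) = S_matrix i *v (\<chi> j. curvature (v $ j))"
proof -
  have "curvature (swap i v $ j) = (\<Sum>k\<in>UNIV. S_matrix i $ j $ k * curvature (v $ k))" for j
  proof (cases "j = i")
    case True
    have "(\<Sum>k\<in>UNIV. S_matrix i $ i $ k * curvature (v $ k))
      = - curvature (v $ i) + (\<Sum>k\<in>UNIV - {i}. 2 * curvature (v $ k))"
      by (subst sum.remove[of _ i]) (auto simp: S_matrix_def intro!: sum.cong)
    then show ?thesis using swap_nth[OF assms, of i] True by (simp add: sum_distrib_left)
  next
    case False
    then show ?thesis by (simp add: swap_other S_matrix_def if_distrib[of "\<lambda>x. x * _"] cong: if_cong)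
  qed
  then show ?thesis by (simp add: vec_eq_iff matrix_vector_mult_def)
qed

end

theory Submission
  imports Defs
begin

text \<open>
  The circles tangent to two given tangent circles form a chain along which the curvature is a
  quadratic polynomial in the index. Choose a quadruple \<open>(a, b, c, p)\<close> with \<open>a\<close> odd, \<open>b\<close> and \<open>c\<close> even
  and \<open>c + p\<close> prime to \<open>m p\<close>. The chain of circles tangent to \<open>C\<^sub>p\<close> and to the third circle has
  discriminant \<open>4 p c\<close>, which is not a square, so Bunyakovsky's conjecture yields a circle of prime
  curvature \<open>q\<close> in it with \<open>q\<close>, \<open>q + p\<close> and \<open>q + l\<close> units modulo \<open>m\<close>; three values can be avoided
  modulo each prime factor of \<open>m\<close> because these are at least \<open>7\<close>.
  The curvatures of the circles tangent to this circle are \<open>F(x, y) - q\<close> for a binary form \<open>F\<close> of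
  discriminant \<open>- 4 q\<^sup>2\<close>, and the last two factors of the word reach every \<open>(x, y)\<close> modulo \<open>m\<close> with
  \<open>y\<close> a unit. Completing the square turns \<open>F(x, y) = q + l\<close> into \<open>X\<^sup>2 + Y\<^sup>2 = w\<close> with units \<open>w\<close> and
  \<open>Y\<close>, which is solvable modulo \<open>m\<close>.
  Primitivity enters through the fact that all circles have integral coordinates with respect to the
  inversive coordinate vectors of a generating quadruple, so that an odd prime cannot divide all
  curvatures of one quadruple.
\<close>

no_notation fps_nth (infixl "$" 75)

subsection \<open>Swaps in inversive coordinates\<close>

lemma bil_sum: "bil (sum f A) u = (\<Sum>i\<in>A. bil (f i) u)" "bil u (sum f A) = (\<Sum>i\<in>A. bil u (f i))"
proof -
  have "bil 0 u = 0" "bil u 0 = 0" by (simp_all add: bil_def)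
  then show "bil (sum f A) u = (\<Sum>i\<in>A. bil (f i) u)" "bil u (sum f A) = (\<Sum>i\<in>A. bil u (f i))"
    by (induction A rule: infinite_finite_induct) (simp_all add: bil_add)
qed

lemma curvature_co: "curvature C = fst (co C)"
  by (simp add: co_def)

lemma gram:
  assumes "pairwise_tangent v"
  shows "bil (co (v $ i)) (co (v $ j)) = (if i = j then 1 else - 1)"
proof -
  have t: "tangent (v $ i) (v $ j)" if "i \<noteq> j" for i j
    using assms that by (simp add: pairwise_tangent_def)
  \<comment> \<open>Any second index will do: tangency with it provides the \<open>is_circle\<close>
    needed for the diagonal entries.\<close>
  have "card (UNIV - {i} :: 4 set) = 3" by simp
  then have "UNIV - {i} \<noteq> {}" by (metis card.empty zero_neq_numeral)
  then obtain k where "k \<noteq> i" by blast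
  then have "is_circle (v $ i)" using tangent_imp[OF t[of i k]] by auto
  then show ?thesis using tangent_imp[OF t] ip_self by (cases "i = j") (auto simp flip: ip_co)
qed

text \<open>By \<open>other_vector\<close> only two vectors have the required products with the
  three fixed circles, and \<open>co_inj\<close> rules out that of the old circle.\<close>

lemma co_swap:
  assumes "pairwise_tangent v"
  shows "co (swap i v $ i) = 2 *\<^sub>R (\<Sum>k\<in>UNIV - {i}. co (v $ k)) - co (v $ i)"
proof -
  have "card (UNIV - {i} :: 4 set) = 3" by simp
  then obtain A B C where ABC: "UNIV - {i} = {A, B, C}" "A \<noteq> B" "A \<noteq> C" "B \<noteq> C"
    unfolding card_3_iff by metis
  then have ni: "A \<noteq> i" "B \<noteq> i" "C \<noteq> i" by blast+
  let ?E = "swap i v $ i"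
  have E: "?E \<noteq> v $ i" "tangent ?E (v $ A)" "tangent ?E (v $ B)" "tangent ?E (v $ C)"
    using swap_nth[OF assms, of i] ni by auto
  have ce: "is_circle ?E" "is_circle (v $ i)"
    using E(2) pairwise_tangent_def[of v] assms ni by (auto simp: tangent_def)
  have e: "bil (co ?E) (co ?E) = 1" "bil (co ?E) (co (v $ A)) = - 1"
    "bil (co ?E) (co (v $ B)) = - 1" "bil (co ?E) (co (v $ C)) = - 1"
    using E(2-4)[THEN tangent_imp] ip_self ce(1) by (auto simp flip: ip_co)
  have "co ?E = co (v $ i) \<or> co ?E = 2 *\<^sub>R (co (v $ A) + co (v $ B) + co (v $ C)) - co (v $ i)"
    by (intro other_vector) (use e ABC ni in \<open>auto simp: gram[OF assms]\<close>)
  moreover have "co ?E \<noteq> co (v $ i)" using co_inj ce E(1) by blast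
  ultimately show ?thesis using ABC by (simp add: add.assoc)
qed

text \<open>
  The solution of \<open>y (k + 1) + y (k - 1) = 2 y k + 2 S\<close>, which is the recursion of alternating
  swaps when \<open>S\<close> is the sum over the two fixed circles.
\<close>

definition chain :: "'a::real_vector \<Rightarrow> 'a \<Rightarrow> 'a \<Rightarrow> int \<Rightarrow> 'a" where
  "chain S y0 y1 k = of_int (k * (k - 1)) *\<^sub>R S + of_int k *\<^sub>R (y1 - y0) + y0"

lemma chain_shift: "chain S (chain S y0 y1 a) (chain S y0 y1 (a + 1)) k = chain S y0 y1 (a + k)"
  unfolding chain_def by (simp add: algebra_simps flip: scaleR_2)

text \<open>Beginning with the other letter runs through the chain backwards; this handles negative
  arguments of \<open>W\<close>.\<close>

lemma chain_flip: "chain S y1 y0 k = chain S y0 y1 (1 - k)"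
  unfolding chain_def by (simp add: algebra_simps)

lemma chain_simps [simp]: "chain S y0 y1 0 = y0" "chain S y0 y1 1 = y1"
  by (simp_all add: chain_def)

lemma fst_chain: "fst (chain S y0 y1 k) = chain (fst S) (fst y0) (fst y1) k"
  by (simp add: chain_def)

lemma bil_chain: "bil (chain S y0 y1 k) u = chain (bil S u) (bil y0 u) (bil y1 u) k"
  by (simp add: chain_def bil_lin)

section \<open>Words acting on quadruples\<close>

abbreviation act :: "4 list \<Rightarrow> circle ^ 4 \<Rightarrow> circle ^ 4" where
  "act w v \<equiv> foldr swap w v"

text \<open>Letters act from the right, so \<open>w\<close> accounts for the first
  \<open>length w\<close> stages of \<open>u @ w\<close>.\<close>

lemma word_quadruple_append:
  "word_quadruple (u @ w) v (length w) = word_quadruple w v (length w)"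
  "word_quadruple (u @ w) v (length w + k) = word_quadruple u (word_quadruple w v (length w)) k"
proof -
  have "j \<le> length w \<Longrightarrow> word_quadruple (u @ w) v j = word_quadruple w v j" for j
    by (induction j) (auto simp: nth_append)
  then show *: "word_quadruple (u @ w) v (length w) = word_quadruple w v (length w)" by simp
  show "word_quadruple (u @ w) v (length w + k) = word_quadruple u (word_quadruple w v (length w)) k"
    by (induction k) (auto simp: * nth_append)
qed

lemma word_quadruple_length: "word_quadruple w v (length w) = act w v"
proof (induction w)
  case (Cons a w)
  have "word_quadruple ([a] @ w) v (length w + 1) = swap a (act w v)"
    by (subst word_quadruple_append) (simp add: Cons)
  then show ?case by simp
qed simp

text \<open>Every suffix of a word is a stage of its evaluation; this places intermediate circles in
  the family.\<close>

lemma word_family_suffix: "act w v $ i \<in> word_family (u @ w) v"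
proof -
  have "word_quadruple (u @ w) v (length w) = act w v"
    by (simp add: word_quadruple_append word_quadruple_length)
  then show ?thesis unfolding word_family_def by (metis (mono_tags, lifting) le_add2 length_append mem_Collect_eq)
qed

lemma descartes_quadruple_swap:
  assumes P: "apollonian_packing P" and v: "descartes_quadruple P v"
  shows "descartes_quadruple P (swap i v)"
proof -
  have pt: "pairwise_tangent v" and vP: "v $ k \<in> P" for k using v by (auto simp: descartes_quadruple_def)
  have "card (UNIV - {i} :: 4 set) = 3" by simp
  then obtain A B C where ABC: "UNIV - {i} = {A, B, C}" "A \<noteq> B" "A \<noteq> C" "B \<noteq> C"
    unfolding card_3_iff by metis
  then have ni: "A \<noteq> i" "B \<noteq> i" "C \<noteq> i" by blast+
  have t: "tangent (v $ A) (v $ B)" "tangent (v $ B) (v $ C)" "tangent (v $ A) (v $ C)"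
    using pt ABC by (auto simp: pairwise_tangent_def)
  have s: "tangent (swap i v $ i) (v $ k)" if "k \<noteq> i" for k using swap_nth[OF pt, of i] that by blast
  obtain v0 where v0: "P = packing_from v0" using P by (auto simp: apollonian_packing_def)
  have "swap i v $ i \<in> P" unfolding v0
    by (rule packing_from.add[of "v $ A" _ "v $ B" "v $ C"]) (use vP v0 t s ni in auto)
  then have "swap i v $ k \<in> P" for k using vP by (cases "k = i") (auto simp: swap_other)
  then show ?thesis using pairwise_tangent_swap[OF pt] by (simp add: descartes_quadruple_def)
qed

lemma descartes_quadruple_act:
  assumes "apollonian_packing P" "descartes_quadruple P v"
  shows "descartes_quadruple P (act w v)"
  by (induction w) (auto simp: assms descartes_quadruple_swap)

lemma pairwise_tangent_act: "pairwise_tangent v \<Longrightarrow> pairwise_tangent (act w v)"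
  by (induction w) (auto simp: pairwise_tangent_swap)

text \<open>The even length keeps the two moving circles in fixed slots: each pair of letters
  advances both chain indices by two.\<close>

lemma act_alternating_word:
  assumes "pairwise_tangent v" "i \<noteq> j"
  defines "S \<equiv> \<Sum>k\<in>UNIV - {i, j}. co (v $ k)"
  shows "(\<forall>k. k \<noteq> i \<longrightarrow> k \<noteq> j \<longrightarrow> act (alternating_word j i (2 * n)) v $ k = v $ k) \<and>
    co (act (alternating_word j i (2 * n)) v $ i) = chain S (co (v $ i)) (co (v $ j)) (2 * int n) \<and>
    co (act (alternating_word j i (2 * n)) v $ j) = chain S (co (v $ i)) (co (v $ j)) (2 * int n + 1)"
  using assms(1) unfolding S_def
proof (induction n arbitrary: v)
  case 0
  then show ?case by simp
next
  case (Suc n)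
  define S where "S = (\<Sum>k\<in>UNIV - {i, j}. co (v $ k))"
  let ?v1 = "swap i v" and ?v2 = "swap j (swap i v)"
  have pt: "pairwise_tangent ?v1" "pairwise_tangent ?v2" by (simp_all add: Suc.prems pairwise_tangent_swap)
  have fixd: "?v2 $ k = v $ k" if "k \<noteq> i" "k \<noteq> j" for k using that by (simp add: swap_other)
  have S2: "(\<Sum>k\<in>UNIV - {i, j}. co (?v2 $ k)) = S" unfolding S_def by (intro sum.cong) (auto simp: fixd)
  have rem: "(\<Sum>k\<in>UNIV - {i}. f k) = f j + (\<Sum>k\<in>UNIV - {i, j}. f k)"
    "(\<Sum>k\<in>UNIV - {j}. f k) = f i + (\<Sum>k\<in>UNIV - {i, j}. f k)" for f :: "4 \<Rightarrow> quad"
    using assms(2) by (subst sum.remove[of _ j] sum.remove[of _ i]; auto intro!: sum.cong)+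
  have ci: "co (?v1 $ i) = chain S (co (v $ i)) (co (v $ j)) 2"
    unfolding co_swap[OF Suc.prems] rem S_def[symmetric] chain_def by (simp add: algebra_simps scaleR_2)
  have S1: "(\<Sum>k\<in>UNIV - {i, j}. co (?v1 $ k)) = S" unfolding S_def by (intro sum.cong) (auto simp: swap_other)
  have cj: "co (?v2 $ j) = chain S (co (v $ i)) (co (v $ j)) 3"
    unfolding co_swap[OF pt(1)] rem S1 ci unfolding chain_def using assms(2)
    by (simp add: swap_other prod_eq_iff complex_eq_iff)
  have ci2: "co (?v2 $ i) = chain S (co (v $ i)) (co (v $ j)) 2" using ci assms(2) by (simp add: swap_other)
  \<comment> \<open>The two letters split off are those that act first, so the induction hypothesis
    applies to \<open>?v2\<close> and the chain is restarted at index \<open>2\<close>.\<close>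
  have w: "alternating_word j i (2 * Suc n) = alternating_word j i (2 * n) @ [j, i]" by simp
  have cc: "chain S (co (?v2 $ i)) (co (?v2 $ j)) k = chain S (co (v $ i)) (co (v $ j)) (2 + k)" for k
    unfolding ci2 cj using chain_shift[of S "co (v $ i)" "co (v $ j)" 2 k] by simp
  show ?case using Suc.IH[OF pt(2)] unfolding w S2 cc S_def[symmetric] by (simp add: fixd add.commute add.left_commute)
qed

lemma act_W:
  assumes "pairwise_tangent v" "i \<noteq> j" "even s"
  defines "S \<equiv> \<Sum>k\<in>UNIV - {i, j}. co (v $ k)"
  shows "k \<noteq> i \<Longrightarrow> k \<noteq> j \<Longrightarrow> act (W j i s) v $ k = v $ k"
    "co (act (W j i s) v $ i) = chain S (co (v $ i)) (co (v $ j)) s"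
    "co (act (W j i s) v $ j) = chain S (co (v $ i)) (co (v $ j)) (s + 1)"
proof -
  obtain r where r: "s = 2 * r" using assms(3) by blast
  have "(k \<noteq> i \<longrightarrow> k \<noteq> j \<longrightarrow> act (W j i s) v $ k = v $ k) \<and>
    co (act (W j i s) v $ i) = chain S (co (v $ i)) (co (v $ j)) s \<and>
    co (act (W j i s) v $ j) = chain S (co (v $ i)) (co (v $ j)) (s + 1)"
  proof (cases "r \<ge> 0")
    case True
    then have "W j i s = alternating_word j i (2 * nat r)" by (simp add: W_def r nat_mult_distrib)
    then show ?thesis using act_alternating_word[OF assms(1,2), of "nat r"] True by (simp add: S_def r)
  next
    case False
    then have "W j i s = alternating_word i j (2 * nat (- r))" by (simp add: W_def r nat_mult_distrib flip: mult_minus_right)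
    then show ?thesis using act_alternating_word[OF assms(1) assms(2)[symmetric], of "nat (- r)"] False
      by (simp add: S_def r insert_commute chain_flip[of _ "co (v $ j)"] add.commute)
  qed
  then show "k \<noteq> i \<Longrightarrow> k \<noteq> j \<Longrightarrow> act (W j i s) v $ k = v $ k"
    "co (act (W j i s) v $ i) = chain S (co (v $ i)) (co (v $ j)) s"
    "co (act (W j i s) v $ j) = chain S (co (v $ i)) (co (v $ j)) (s + 1)" by blast+
qed

subsection \<open>Integrality of inversive coordinates\<close>

text \<open>
  The Gram matrix of a quadruple of pairwise tangent circles has square \<open>4\<close>, so its inverse is a
  quarter of it.
\<close>

definition coord :: "circle ^ 4 \<Rightarrow> 4 \<Rightarrow> quad \<Rightarrow> real" where
  "coord v i u = (2 * bil u (co (v $ i)) - (\<Sum>k\<in>UNIV. bil u (co (v $ k)))) / 4"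

lemma coord_sum_scale: "coord v i (\<Sum>j\<in>A. f j *\<^sub>R g j) = (\<Sum>j\<in>A. f j * coord v i (g j))"
proof -
  have "(\<Sum>k\<in>UNIV. bil (\<Sum>j\<in>A. f j *\<^sub>R g j) (co (v $ k))) = (\<Sum>j\<in>A. f j * (\<Sum>k\<in>UNIV. bil (g j) (co (v $ k))))"
    by (simp add: bil_sum bil_scale sum_4 sum.distrib sum_distrib_left distrib_left)
  then show ?thesis
    unfolding coord_def
    by (simp add: bil_sum bil_scale sum_divide_distrib sum_subtractf sum_distrib_left right_diff_distrib diff_divide_distrib mult_ac)
qed

text \<open>The difference of the two sides is orthogonal to all four vectors, so
  \<open>gram_span\<close> makes it vanish.\<close>

lemma coord_expansion:
  assumes "pairwise_tangent v"
  shows "(\<Sum>i\<in>UNIV. coord v i u *\<^sub>R co (v $ i)) = u"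
proof -
  let ?u = "\<Sum>i\<in>UNIV. coord v i u *\<^sub>R co (v $ i)"
  have "bil (?u - u) (co (v $ j)) = 0" for j
    unfolding sum_4 bil_lin gram[OF assms] using exhaust_4[of j]
    by (auto simp: coord_def sum_4 field_simps)
  then have "?u - u = 0"
    by (intro gram_span[of "co (v $ 1)" "co (v $ 2)" "co (v $ 3)" "co (v $ 4)"]) (simp_all add: gram[OF assms])
  then show ?thesis by simp
qed

lemma coord_self: "pairwise_tangent v \<Longrightarrow> coord v i (co (v $ j)) = (if i = j then 1 else 0)"
  using exhaust_4[of i] exhaust_4[of j] by (auto simp: coord_def sum_4 gram)

text \<open>For pairwise tangent \<open>v\<close> this is the integer span of the vectors
  \<open>co (v $ i)\<close>, by \<open>coord_expansion\<close>.\<close>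

definition in_lattice :: "circle ^ 4 \<Rightarrow> quad \<Rightarrow> bool" where
  "in_lattice v u \<longleftrightarrow> (\<forall>i. coord v i u \<in> \<int>)"

lemma bil_lattice:
  assumes "pairwise_tangent v" "in_lattice v u" "in_lattice v u'"
  shows "bil u u' \<in> \<int>"
proof -
  have "bil u u' = bil (\<Sum>i\<in>UNIV. coord v i u *\<^sub>R co (v $ i)) (\<Sum>i\<in>UNIV. coord v i u' *\<^sub>R co (v $ i))"
    using assms(1) by (simp add: coord_expansion)
  also have "\<dots> \<in> \<int>"
    using assms(2,3) unfolding bil_sum bil_scale gram[OF assms(1)] in_lattice_def
    by (intro Ints_sum Ints_mult) auto
  finally show ?thesis .
qed

lemma in_lattice_basis: "pairwise_tangent v \<Longrightarrow> in_lattice v (co (v $ i))"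
  by (simp add: in_lattice_def coord_self)

lemma det_Ints:
  fixes A :: "real ^ 'n ^ 'n"
  assumes "\<And>i j. A $ i $ j \<in> \<int>"
  shows "det A \<in> \<int>"
  unfolding det_def using assms by (intro Ints_sum Ints_mult Ints_prod) auto

text \<open>
  The coordinate matrix of one quadruple with respect to another preserves the Gram matrix, so its
  determinant is \<open>\<plusminus>1\<close>. By Cramer's rule the coordinates along the fourth circle of \<open>y\<close> are
  then determinants involving only the other three.
\<close>

lemma coord_det:
  assumes x: "pairwise_tangent x" and y: "pairwise_tangent y"
  defines "M \<equiv> (\<chi> i j. coord x i (co (y $ j))) :: real ^ 4 ^ 4"
  shows "\<bar>det M\<bar> = 1"
proof -
  define G :: "real ^ 4 ^ 4" where "G = (\<chi> i j. if i = j then 1 else - 1)"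
  have "transpose M ** (G ** M) = G"
  proof -
    have "(transpose M ** (G ** M)) $ j $ k = bil (co (y $ j)) (co (y $ k))" for j k
    proof -
      have "bil (co (y $ j)) (co (y $ k)) =
        bil (\<Sum>i\<in>UNIV. M $ i $ j *\<^sub>R co (x $ i)) (\<Sum>l\<in>UNIV. M $ l $ k *\<^sub>R co (x $ l))"
        using x by (simp add: M_def coord_expansion)
      also have "\<dots> = (\<Sum>i\<in>UNIV. M $ i $ j * (\<Sum>l\<in>UNIV. G $ i $ l * M $ l $ k))"
        unfolding bil_sum bil_scale gram[OF x]
        by (simp add: G_def sum_distrib_left mult_ac, subst sum.swap, simp add: mult_ac)
      finally show ?thesis by (simp add: matrix_matrix_mult_def transpose_def)
    qed
    then show ?thesis by (simp add: vec_eq_iff gram[OF y] G_def)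
  qed
  then have "det M * (det G * det M) = det G" by (metis det_mul det_transpose)
  moreover have "det G \<noteq> 0"
  proof -
    have "G ** (\<chi> i j. if i = j then 1 / 4 else - (1 / 4)) = mat 1"
      by (simp add: vec_eq_iff matrix_matrix_mult_def G_def mat_def forall_4 sum_4)
    then have "det (G ** (\<chi> i j. if i = j then 1 / 4 else - (1 / 4))) = 1" by simp
    then show ?thesis unfolding det_mul by auto
  qed
  ultimately have "det M * det M = 1" by (simp add: mult.left_commute)
  then show ?thesis by (auto simp: square_eq_1_iff)
qed

lemma in_lattice_fourth:
  assumes x: "pairwise_tangent x" and y: "pairwise_tangent y"
    and l: "\<And>j. j \<noteq> 4 \<Longrightarrow> in_lattice x (co (y $ j))"
  shows "in_lattice x (co (y $ 4))"
proof -
  define M :: "real ^ 4 ^ 4" where "M = (\<chi> i j. coord x i (co (y $ j)))"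
  \<comment> \<open>These are the entries of the fourth row of the inverse of
    \<open>M\<close>.\<close>
  define z where "z i = coord y 4 (co (x $ i))" for i
  have Mint: "M $ i $ j \<in> \<int>" if "j \<noteq> 4" for i j using l[OF that] by (simp add: M_def in_lattice_def)
  have z: "z i \<in> \<int>" for i
  proof -
    define \<xi> :: "real ^ 4" where "\<xi> = (\<chi> j. coord y j (co (x $ i)))"
    have cols: "(M *v \<xi>) $ k = (if k = i then 1 else 0)" for k
    proof -
      have cols: "(M *v \<xi>) $ k = coord x k (\<Sum>j\<in>UNIV. coord y j (co (x $ i)) *\<^sub>R co (y $ j))"
        unfolding coord_sum_scale by (simp add: matrix_vector_mult_def M_def \<xi>_def mult.commute)
      then show ?thesis using x y by (simp add: coord_expansion coord_self)
    qed
    \<comment> \<open>Cramer's rule puts a unit vector in place of the only column not known to be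
      integral.\<close>
    have "det ((\<chi> k j. if j = 4 then if k = i then 1 else 0 else M $ k $ j) :: real ^ 4 ^ 4) = \<xi> $ 4 * det M"
      using cramer_lemma[where A = M and x = \<xi> and k = 4] unfolding cols .
    moreover have "det ((\<chi> k j. if j = 4 then if k = i then 1 else 0 else M $ k $ j) :: real ^ 4 ^ 4) \<in> \<int>"
      by (intro det_Ints) (auto intro: Mint)
    moreover have "det M = 1 \<or> det M = - 1" using coord_det[OF x y] unfolding M_def by linarith
    ultimately show ?thesis by (auto simp: \<xi>_def z_def)
  qed
  \<comment> \<open>Solving the definition of \<open>z i\<close> for the product with
    \<open>y $ 4\<close> lets the denominator \<open>4\<close> cancel in the coordinates
    below.\<close>
  have "bil (co (y $ 4)) (co (x $ i)) = 4 * z i + bil (co (y $ 1)) (co (x $ i))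
      + bil (co (y $ 2)) (co (x $ i)) + bil (co (y $ 3)) (co (x $ i))" for i
    by (simp add: z_def coord_def sum_4 bil_sym[of "co (x $ i)"] field_simps)
  then have "coord x i (co (y $ 4)) = 2 * z i - (\<Sum>k\<in>UNIV. z k) + M $ i $ 1 + M $ i $ 2 + M $ i $ 3" for i
    by (simp add: coord_def sum_4 M_def field_simps)
  then show ?thesis unfolding in_lattice_def using z Mint by (simp add: sum_4)
qed

definition quadruple :: "circle \<Rightarrow> circle \<Rightarrow> circle \<Rightarrow> circle \<Rightarrow> circle ^ 4" where
  "quadruple A B C D = (\<chi> i. if i = 1 then A else if i = 2 then B else if i = 3 then C else D)"

lemma quadruple_nth [simp]: "quadruple A B C D $ 1 = A" "quadruple A B C D $ 2 = B"
  "quadruple A B C D $ 3 = C" "quadruple A B C D $ 4 = D"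
  by (simp_all add: quadruple_def)

text \<open>The rule \<open>add\<close> supplies no fourth circle of which the new one would be a
  swap. The new circle is therefore treated as the fourth member of a quadruple whose other members
  lie in the lattice.\<close>

lemma packing_in_lattice:
  assumes "pairwise_tangent x" "D \<in> packing_from x"
  shows "in_lattice x (co D)"
  using assms(2)
proof induction
  case (start i)
  then show ?case using assms(1) by (simp add: in_lattice_basis)
next
  case (add A B C D)
  let ?y = "quadruple A B C D"
  have "pairwise_tangent ?y" using add.hyps tangent_sym by (simp add: pairwise_tangent_iff)
  moreover have "in_lattice x (co (?y $ j))" if "j \<noteq> 4" for j using exhaust_4[of j] that add.IH by auto
  ultimately have "in_lattice x (co (?y $ 4))" by (intro in_lattice_fourth[OF assms(1)])
  then show ?case by simp
qed

text \<open>The vectors of \<open>D\<close> and of \<open>y\<close> lie in the lattice of one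
  generating quadruple, so their products are integers and \<open>4\<close> times each coordinate of
  \<open>D\<close> along \<open>y\<close> is an integer.\<close>

lemma dvd_packing:
  assumes P: "apollonian_packing P" and y: "descartes_quadruple P y" and D: "D \<in> P"
    and c: "\<And>i. curvature (y $ i) = of_int (d * a i)" and e: "curvature D = of_int e"
  shows "d dvd 4 * e"
proof -
  obtain x where x: "pairwise_tangent x" "P = packing_from x" using P by (auto simp: apollonian_packing_def)
  have y': "pairwise_tangent y" "y $ i \<in> P" for i using y by (auto simp: descartes_quadruple_def)
  have "bil (co D) (co (y $ i)) \<in> \<int>" for i
    using bil_lattice[OF x(1)] packing_in_lattice[OF x(1)] D y'(2) x(2) by blast
  moreover have "4 * coord y i (co D) = 2 * bil (co D) (co (y $ i)) - (\<Sum>k\<in>UNIV. bil (co D) (co (y $ k)))" for i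
    by (simp add: coord_def)
  ultimately have "4 * coord y i (co D) \<in> \<int>" for i by (simp add: Ints_sum Ints_mult)
  then have "\<forall>i. \<exists>k. 4 * coord y i (co D) = of_int k" by (auto simp: Ints_def)
  from choice[OF this] obtain f where f: "\<And>i. 4 * coord y i (co D) = of_int (f i)" by blast
  have "4 * of_int e = 4 * fst (\<Sum>i\<in>UNIV. coord y i (co D) *\<^sub>R co (y $ i))"
    using coord_expansion[OF y'(1)] e by (simp add: curvature_co)
  also have "\<dots> = (\<Sum>i\<in>UNIV. 4 * coord y i (co D) * curvature (y $ i))"
    by (simp add: sum_4 curvature_co)
  also have "\<dots> = of_int (d * (\<Sum>i\<in>UNIV. f i * a i))"
    unfolding f c by (simp add: sum_distrib_left mult_ac)
  finally have "4 * e = d * (\<Sum>i\<in>UNIV. f i * a i)" by linarith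
  then show ?thesis by simp
qed

lemma in_quadruple:
  assumes "apollonian_packing P" "D \<in> P"
  shows "\<exists>v. descartes_quadruple P v \<and> (\<exists>i. v $ i = D)"
proof -
  obtain x where x: "pairwise_tangent x" "P = packing_from x" using assms by (auto simp: apollonian_packing_def)
  from assms(2)[unfolded x(2)] show ?thesis
  proof cases
    case (start i)
    then show ?thesis using x by (auto simp: descartes_quadruple_def intro: packing_from.start)
  next
    case (add A B C)
    let ?y = "quadruple A B C D"
    have "pairwise_tangent ?y" using add tangent_sym by (simp add: pairwise_tangent_iff)
    then have "descartes_quadruple P ?y"
      using add assms(2) x(2) unfolding descartes_quadruple_def forall_4 by simp
    then show ?thesis by (metis quadruple_nth(4))
  qed
qed

subsection \<open>Congruences\<close>

lemma chinese_remainder_int_set: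
  fixes m u :: "'a \<Rightarrow> int"
  assumes "finite A" "\<And>i j. i \<in> A \<Longrightarrow> j \<in> A \<Longrightarrow> i \<noteq> j \<Longrightarrow> coprime (m i) (m j)"
  shows "\<exists>x. \<forall>i\<in>A. [x = u i] (mod m i)"
  using assms
proof (induction A rule: finite_induct)
  case (insert a A)
  then obtain x where x: "\<And>i. i \<in> A \<Longrightarrow> [x = u i] (mod m i)" by auto
  have "coprime (m a) (\<Prod>i\<in>A. m i)" using insert by (intro prod_coprime_right) auto
  from binary_chinese_remainder_int[OF this] obtain y
    where y: "[y = u a] (mod m a)" "[y = x] (mod (\<Prod>i\<in>A. m i))" by blast
  have "[y = u i] (mod m i)" if "i \<in> A" for i
    using y(2) x[OF that] that insert.hyps(1) by (meson cong_dvd_modulus cong_trans dvd_prodI)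
  then show ?case using y by auto
qed simp

lemma chinese_remainder_prime_powers:
  fixes m :: int and u :: "int \<Rightarrow> int"
  shows "\<exists>x. \<forall>q\<in>prime_factors m. [x = u q] (mod q ^ multiplicity q m)"
proof (rule chinese_remainder_int_set)
  fix p q :: int assume "p \<in> prime_factors m" "q \<in> prime_factors m" "p \<noteq> q"
  then have "coprime p q" by (intro primes_coprime) auto
  then show "coprime (p ^ multiplicity p m) (q ^ multiplicity q m)" by simp
qed simp

lemma chinese_remainder_primes:
  fixes m :: int and u :: "int \<Rightarrow> int"
  shows "\<exists>x. \<forall>q\<in>prime_factors m. [x = u q] (mod q)"
  by (rule chinese_remainder_int_set) (auto intro: primes_coprime)

lemma cong_prime_powers:
  fixes m a b :: int
  assumes "m \<noteq> 0" "\<And>q. q \<in> prime_factors m \<Longrightarrow> [a = b] (mod q ^ multiplicity q m)"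
  shows "[a = b] (mod m)"
proof (cases "a = b")
  case False
  have "multiplicity q m \<le> multiplicity q (a - b)" if "prime q" for q
  proof (cases "q dvd m")
    case True
    then have "q ^ multiplicity q m dvd a - b"
      using assms that by (simp add: prime_factors_dvd cong_iff_dvd_diff)
    then show ?thesis using that False by (intro multiplicity_geI) (auto simp: not_prime_unit)
  qed (simp add: not_dvd_imp_multiplicity_0)
  then have "m dvd a - b" using assms(1) by (intro multiplicity_le_imp_dvd)
  then show ?thesis by (simp add: cong_iff_dvd_diff)
qed simp

lemma coprime_iff_primes:
  fixes m a :: int
  assumes "m \<noteq> 0"
  shows "coprime a m \<longleftrightarrow> (\<forall>q\<in>prime_factors m. \<not> q dvd a)"
proof
  assume "coprime a m"
  then show "\<forall>q\<in>prime_factors m. \<not> q dvd a"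
    by (meson coprime_common_divisor in_prime_factors_iff not_prime_unit)
next
  assume *: "\<forall>q\<in>prime_factors m. \<not> q dvd a"
  show "coprime a m"
  proof (rule ccontr)
    assume "\<not> coprime a m"
    then have "gcd a m \<noteq> 1" by (simp add: coprime_iff_gcd_eq_1)
    then obtain q where "prime q" "q dvd gcd a m" using prime_divisor_exists[of "gcd a m"] assms by auto
    then show False using * assms by (auto simp: prime_factors_dvd)
  qed
qed

lemma int_prime_pos: "prime (q :: int) \<Longrightarrow> q > 1"
  by (rule prime_gt_1_int)

lemma prime_dvd_two: "prime (q :: int) \<Longrightarrow> odd q \<Longrightarrow> \<not> q dvd 2"
proof
  assume "prime q" "odd q" "q dvd 2"
  moreover have "prime (2 :: int)" by simp
  ultimately show False using primes_dvd_imp_eq by blast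
qed

section \<open>Sums of two squares modulo an odd number prime to 5\<close>

text \<open>Hensel lifting, one power of \<open>q\<close> at a time; \<open>2 * y\<close> stays
  invertible modulo \<open>q\<close>.\<close>

lemma square_root_lift:
  fixes q y0 n :: int
  assumes q: "prime q" "odd q" and y0: "q dvd y0\<^sup>2 - n" "\<not> q dvd y0"
  shows "\<exists>y. q ^ Suc e dvd y\<^sup>2 - n \<and> \<not> q dvd y"
proof (induction e)
  case 0
  then show ?case using y0 by auto
next
  case (Suc e)
  then obtain y k where y: "y\<^sup>2 - n = q ^ Suc e * k" "\<not> q dvd y" by auto
  have "\<not> q dvd 2 * y" using q y(2) prime_dvd_two by (simp add: prime_dvd_mult_iff)
  then have "coprime (2 * y) q" using q(1) by (metis coprime_commute prime_imp_coprime)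
  then obtain i where i: "[2 * y * i = 1] (mod q)" using cong_solve_coprime_int by blast
  \<comment> \<open>The Newton correction: it solves the linearized congruence
    \<open>k + 2 * y * z = 0\<close> modulo \<open>q\<close>.\<close>
  define z where "z = - k * i"
  have "q dvd k + 2 * y * z"
  proof -
    have "k + 2 * y * z = - k * (2 * y * i - 1)" by (simp add: z_def algebra_simps)
    then show ?thesis using i by (simp add: cong_iff_dvd_diff)
  qed
  then obtain r where r: "k + 2 * y * z = q * r" by blast
  have "(y + q ^ Suc e * z)\<^sup>2 - n = q ^ Suc e * (k + 2 * y * z) + q ^ Suc e * q ^ Suc e * z\<^sup>2"
    using y(1) by (simp add: power2_eq_square algebra_simps)
  also have "\<dots> = q ^ Suc (Suc e) * (r + q ^ e * z\<^sup>2)"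
    unfolding r by (simp add: algebra_simps)
  finally have "q ^ Suc (Suc e) dvd (y + q ^ Suc e * z)\<^sup>2 - n" by simp
  moreover have "\<not> q dvd y + q ^ Suc e * z" using y(2) by (simp add: dvd_add_left_iff)
  ultimately show ?case by blast
qed

text \<open>Both \<open>x - y\<close> and \<open>x + y\<close> are smaller than \<open>q\<close> in
  absolute value, so whichever of them \<open>q\<close> divides must vanish.\<close>

lemma square_mod_inj:
  fixes q :: int
  assumes "prime q"
  shows "inj_on (\<lambda>x. x\<^sup>2 mod q) {0..(q - 1) div 2}"
proof (rule inj_onI)
  fix x y assume xy: "x \<in> {0..(q - 1) div 2}" "y \<in> {0..(q - 1) div 2}" "x\<^sup>2 mod q = y\<^sup>2 mod q"
  then have b: "0 \<le> x" "0 \<le> y" "2 * x \<le> q - 1" "2 * y \<le> q - 1" by auto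
  have "q dvd x\<^sup>2 - y\<^sup>2" using xy(3) by (simp add: mod_eq_dvd_iff)
  also have "x\<^sup>2 - y\<^sup>2 = (x - y) * (x + y)" by (simp add: power2_eq_square algebra_simps)
  finally have "q dvd x - y \<or> q dvd x + y" using assms by (simp add: prime_dvd_mult_iff)
  then have "x - y = 0 \<or> x + y = 0"
    using b dvd_imp_le_int[of "x - y" q] dvd_imp_le_int[of "x + y" q] by linarith
  then show "x = y" using b by linarith
qed

text \<open>Pigeonhole: the squares and the numbers \<open>w - y\<^sup>2\<close> fill
  \<open>(q + 1) div 2\<close> residues each, together more than \<open>q\<close>.\<close>

lemma two_squares_mod_prime:
  fixes q w :: int
  assumes q: "prime q" "odd q"
  shows "\<exists>x y. q dvd x\<^sup>2 + y\<^sup>2 - w"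
proof (rule ccontr)
  assume none: "\<not> ?thesis"
  let ?I = "{0..(q - 1) div 2}"
  let ?f = "\<lambda>x. x\<^sup>2 mod q" and ?g = "\<lambda>y. (w - y\<^sup>2) mod q"
  have pos: "q > 1" using q by (simp add: int_prime_pos)
  have "inj_on ?g ?I"
  proof (rule inj_onI)
    fix x y assume xy: "x \<in> ?I" "y \<in> ?I" "?g x = ?g y"
    then have "q dvd (w - x\<^sup>2) - (w - y\<^sup>2)" by (simp add: mod_eq_dvd_iff)
    then have "q dvd y\<^sup>2 - x\<^sup>2" by (simp add: algebra_simps)
    then have "?f x = ?f y" by (metis mod_eq_dvd_iff)
    then show "x = y" using square_mod_inj[OF q(1)] xy by (auto dest: inj_onD)
  qed
  then have card: "card (?f ` ?I) = nat ((q + 1) div 2)" "card (?g ` ?I) = nat ((q + 1) div 2)"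
    using square_mod_inj[OF q(1)] pos by (simp_all add: card_image)
  have "?f ` ?I \<inter> ?g ` ?I = {}"
  proof (rule ccontr)
    assume "\<not> ?thesis"
    then obtain x y where "?f x = ?g y" by auto
    then have "q dvd x\<^sup>2 - (w - y\<^sup>2)" by (simp add: mod_eq_dvd_iff)
    then show False using none by (metis diff_diff_eq2)
  qed
  then have "card (?f ` ?I \<union> ?g ` ?I) = 2 * nat ((q + 1) div 2)" using card by (simp add: card_Un_disjoint)
  moreover have "card (?f ` ?I \<union> ?g ` ?I) \<le> card {0..<q}" using pos by (intro card_mono) auto
  ultimately show False using pos q(2) by simp
qed

text \<open>For a square \<open>w\<close> the identity \<open>3\<^sup>2 + 4\<^sup>2 = 5\<^sup>2\<close> keeps the second summand invertible.\<close>

lemma two_squares_mod_prime_power: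
  fixes q w :: int
  assumes q: "prime q" "odd q" "q \<noteq> 5" and w: "\<not> q dvd w"
  shows "\<exists>x y. [x\<^sup>2 + y\<^sup>2 = w] (mod q ^ Suc e) \<and> \<not> q dvd y"
proof (cases "\<exists>z. q dvd z\<^sup>2 - w")
  case True
  then obtain z0 where z0: "q dvd z0\<^sup>2 - w" by blast
  have "\<not> q dvd z0"
  proof
    assume "q dvd z0"
    then have "q dvd z0\<^sup>2" by (simp add: power2_eq_square)
    then have "q dvd z0\<^sup>2 - (z0\<^sup>2 - w)" using z0 by (rule dvd_diff)
    then show False using w by simp
  qed
  then obtain z where z: "q ^ Suc e dvd z\<^sup>2 - w" "\<not> q dvd z"
    using square_root_lift[OF q(1,2) z0] by blast
  have "prime (5 :: int)" by simp
  then have "\<not> q dvd 5" using q(1,3) primes_dvd_imp_eq by blast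
  then have "coprime 5 (q ^ Suc e)" using q(1) by (metis coprime_commute coprime_power_right_iff prime_imp_coprime)
  \<comment> \<open>Scaling by the inverse of 5 turns \<open>3 * z\<close> and \<open>4 * z\<close>
    into numbers whose squares add up to \<open>z\<^sup>2\<close>.\<close>
  then obtain i where i: "[5 * i = 1] (mod q ^ Suc e)" using cong_solve_coprime_int by blast
  have ni: "\<not> q dvd i"
  proof
    assume "q dvd i"
    moreover have "q dvd 5 * i - 1" using i by (metis cong_iff_dvd_diff dvd_mult_left power_Suc)
    ultimately have "q dvd 5 * i - (5 * i - 1)" by (rule dvd_diff[OF dvd_mult])
    then have "q dvd 1" by simp
    then show False using q(1) not_prime_unit by blast
  qed
  have "(3 * (i * z))\<^sup>2 + (4 * (i * z))\<^sup>2 = (5 * i)\<^sup>2 * z\<^sup>2" by (simp add: power_mult_distrib)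
  also have "[(5 * i)\<^sup>2 * z\<^sup>2 = 1\<^sup>2 * w] (mod q ^ Suc e)"
    using z(1) by (intro cong_mult cong_pow i) (simp add: cong_iff_dvd_diff)
  finally have "[(3 * (i * z))\<^sup>2 + (4 * (i * z))\<^sup>2 = w] (mod q ^ Suc e)" by simp
  moreover have "\<not> q dvd 4 * (i * z)"
    using ni z(2) q prime_dvd_two prime_dvd_mult_iff[of q 2 2] by (simp add: prime_dvd_mult_iff)
  ultimately show ?thesis by blast
next
  case False
  obtain x y0 where xy: "q dvd x\<^sup>2 + y0\<^sup>2 - w" using two_squares_mod_prime q by blast
  \<comment> \<open>If \<open>q\<close> divided \<open>y0\<close>, then \<open>x\<close> would be a
    square root of \<open>w\<close> modulo \<open>q\<close>, contrary to the case
    assumption.\<close>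
  have "\<not> q dvd y0"
  proof
    assume "q dvd y0"
    then have "q dvd y0\<^sup>2" by (simp add: power2_eq_square)
    moreover have "x\<^sup>2 - w = x\<^sup>2 + y0\<^sup>2 - w - y0\<^sup>2" by simp
    ultimately show False using xy False by (metis dvd_diff)
  qed
  moreover have "q dvd y0\<^sup>2 - (w - x\<^sup>2)" using xy by (simp add: algebra_simps)
  ultimately obtain y where "q ^ Suc e dvd y\<^sup>2 - (w - x\<^sup>2)" "\<not> q dvd y"
    using square_root_lift[OF q(1,2)] by blast
  then show ?thesis by (intro exI[of _ x] exI[of _ y]) (simp add: cong_iff_dvd_diff algebra_simps)
qed

lemma two_squares_mod:
  fixes m w :: int
  assumes m: "m > 0" "odd m" "\<not> 5 dvd m" and w: "coprime w m"
  shows "\<exists>x y. [x\<^sup>2 + y\<^sup>2 = w] (mod m) \<and> coprime y m"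
proof -
  have "\<exists>x y. [x\<^sup>2 + y\<^sup>2 = w] (mod q ^ multiplicity q m) \<and> \<not> q dvd y" if "q \<in> prime_factors m" for q
  proof -
    have q: "prime q" "q dvd m" using that by auto
    then have "odd q" "q \<noteq> 5" using m dvd_trans by blast+
    moreover have "\<not> q dvd w" using w that m coprime_iff_primes[of m w] by auto
    moreover have "multiplicity q m > 0" using that by (simp add: prime_factors_multiplicity)
    then obtain e where "multiplicity q m = Suc e" using gr0_implies_Suc by blast
    ultimately show ?thesis using two_squares_mod_prime_power[OF q(1)] by metis
  qed
  then obtain f g where fg: "\<And>q. q \<in> prime_factors m \<Longrightarrow>
      [(f q)\<^sup>2 + (g q)\<^sup>2 = w] (mod q ^ multiplicity q m) \<and> \<not> q dvd g q" by metis
  obtain x where x: "\<And>q. q \<in> prime_factors m \<Longrightarrow> [x = f q] (mod q ^ multiplicity q m)"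
    using chinese_remainder_prime_powers by blast
  obtain y where y: "\<And>q. q \<in> prime_factors m \<Longrightarrow> [y = g q] (mod q ^ multiplicity q m)"
    using chinese_remainder_prime_powers by blast
  have "[x\<^sup>2 + y\<^sup>2 = w] (mod m)"
  proof (rule cong_prime_powers)
    fix q assume q: "q \<in> prime_factors m"
    show "[x\<^sup>2 + y\<^sup>2 = w] (mod q ^ multiplicity q m)"
      by (rule cong_trans[OF cong_add[OF cong_pow[OF x[OF q]] cong_pow[OF y[OF q]]]]) (use fg q in auto)
  qed (use m in simp)
  moreover have "\<not> q dvd y" if q: "q \<in> prime_factors m" for q
  proof -
    have "multiplicity q m > 0" using q by (simp add: prime_factors_multiplicity)
    then have "q dvd q ^ multiplicity q m" by (rule dvd_power[OF disjI1])
    then have "[y = g q] (mod q)" using y[OF q] by (rule cong_dvd_modulus[rotated])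
    then show ?thesis using fg[OF q] cong_dvd_iff by blast
  qed
  ultimately show ?thesis using m coprime_iff_primes[of m y] by auto
qed

section \<open>Values of quadratic polynomials modulo primes\<close>

text \<open>The values at 0, 1 and -1 recover the coefficients up to a factor 2.\<close>

lemma quadratic_nonzero_mod_prime:
  fixes q \<alpha> \<beta> \<gamma> :: int
  assumes "prime q" "odd q" "\<not> (q dvd \<alpha> \<and> q dvd \<beta> \<and> q dvd \<gamma>)"
  shows "\<exists>k. \<not> q dvd \<alpha> * k\<^sup>2 + \<beta> * k + \<gamma>"
proof (rule ccontr)
  assume "\<not> ?thesis"
  then have *: "q dvd \<alpha> * k\<^sup>2 + \<beta> * k + \<gamma>" for k by blast
  from *[of 0] have c: "q dvd \<gamma>" by simp
  have "q dvd 2 * \<alpha>" using dvd_diff[OF dvd_add[OF *[of 1] *[of "- 1"]] dvd_mult[OF c, of 2]]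
    by (simp add: algebra_simps)
  then have a: "q dvd \<alpha>" using assms prime_dvd_two by (simp add: prime_dvd_mult_iff)
  have "q dvd \<beta>" using dvd_diff[OF dvd_diff[OF *[of 1] a] c] by simp
  then show False using a c assms by blast
qed

lemma quadratic_coprime:
  fixes N \<alpha> \<beta> \<gamma> :: int
  assumes N: "odd N" and prim: "\<And>q. q \<in> prime_factors N \<Longrightarrow> \<not> (q dvd \<alpha> \<and> q dvd \<beta> \<and> q dvd \<gamma>)"
  shows "\<exists>k. even k \<and> coprime (\<alpha> * k\<^sup>2 + \<beta> * k + \<gamma>) N"
proof -
  have N0: "N \<noteq> 0" using N by auto
  have "\<exists>k. \<not> q dvd \<alpha> * k\<^sup>2 + \<beta> * k + \<gamma>" if "q \<in> prime_factors N" for q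
  proof (rule quadratic_nonzero_mod_prime)
    show "odd q" using that N by (metis dvd_trans in_prime_factors_imp_dvd)
  qed (use that prim in auto)
  then obtain u where u: "\<And>q. q \<in> prime_factors N \<Longrightarrow> \<not> q dvd \<alpha> * (u q)\<^sup>2 + \<beta> * u q + \<gamma>" by metis
  obtain x where x: "\<And>q. q \<in> prime_factors N \<Longrightarrow> [x = u q] (mod q)"
    using chinese_remainder_primes by blast
  \<comment> \<open>As \<open>N\<close> is odd, adding \<open>N * x\<close> makes the number even
    without changing it modulo the prime factors of \<open>N\<close>.\<close>
  define k where "k = x + N * x"
  have "\<not> q dvd \<alpha> * k\<^sup>2 + \<beta> * k + \<gamma>" if q: "q \<in> prime_factors N" for q
  proof -
    have "[x + N * x = x + 0] (mod q)" using q by (intro cong_add) (auto simp: cong_0_iff)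
    then have "[k = u q] (mod q)" using x[OF q] by (auto simp: k_def intro: cong_trans)
    then have "[\<alpha> * k\<^sup>2 + \<beta> * k + \<gamma> = \<alpha> * (u q)\<^sup>2 + \<beta> * u q + \<gamma>] (mod q)"
      by (intro cong_add cong_mult cong_pow) auto
    then show ?thesis using u[OF q] cong_dvd_iff by blast
  qed
  moreover have "even k" using N by (auto simp: k_def)
  ultimately show ?thesis using coprime_iff_primes[OF N0] by blast
qed

text \<open>Distinct elements of \<open>{0..6}\<close> stay distinct modulo \<open>q\<close>. Since
  \<open>\<alpha>\<close> is invertible, any two roots have the same sum, which leaves no room for a
  third.\<close>

lemma quadratic_roots_mod_prime:
  fixes q \<alpha> \<beta> \<gamma> :: int
  assumes q: "prime q" "q \<ge> 7" and a: "\<not> q dvd \<alpha>"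
  shows "card {t \<in> {0..6}. q dvd \<alpha> * t\<^sup>2 + \<beta> * t + \<gamma>} \<le> 2"
proof (rule ccontr)
  let ?R = "{t \<in> {0..6}. q dvd \<alpha> * t\<^sup>2 + \<beta> * t + \<gamma>}"
  assume "\<not> ?thesis"
  then have "3 \<le> card ?R" by simp
  then obtain S where "S \<subseteq> ?R" "card S = 3" by (rule obtain_subset_with_card_n)
  then obtain x y z where xyz: "x \<in> ?R" "y \<in> ?R" "z \<in> ?R" "x \<noteq> y" "x \<noteq> z" "y \<noteq> z"
    unfolding card_3_iff by auto
  have nd: "\<not> q dvd u - v" if "u \<in> ?R" "v \<in> ?R" "u \<noteq> v" for u v
  proof
    assume "q dvd u - v"
    then have "q \<le> \<bar>u - v\<bar>" using that dvd_imp_le_int[of "u - v" q] q by auto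
    then show False using that q by auto
  qed
  have lin: "q dvd \<alpha> * (u + v) + \<beta>" if "u \<in> ?R" "v \<in> ?R" "u \<noteq> v" for u v
  proof -
    have "q dvd (\<alpha> * u\<^sup>2 + \<beta> * u + \<gamma>) - (\<alpha> * v\<^sup>2 + \<beta> * v + \<gamma>)"
      using that by (intro dvd_diff) auto
    also have "\<dots> = (u - v) * (\<alpha> * (u + v) + \<beta>)" by (simp add: power2_eq_square algebra_simps)
    finally show ?thesis using nd[OF that] q by (simp add: prime_dvd_mult_iff)
  qed
  have "q dvd (\<alpha> * (x + y) + \<beta>) - (\<alpha> * (x + z) + \<beta>)" using lin xyz by (intro dvd_diff) auto
  also have "\<dots> = \<alpha> * (y - z)" by (simp add: algebra_simps)
  finally show False using nd[of y z] xyz a q by (simp add: prime_dvd_mult_iff)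
qed

subsection \<open>Bunyakovsky's conjecture for an explicit quadratic polynomial\<close>

text \<open>A constant factor divides the content, and a product of linear factors has discriminant
  \<open>(g0 * h1 - g1 * h0)\<^sup>2\<close>.\<close>

lemma irreducible_quadratic:
  fixes \<alpha> \<beta> \<gamma> :: int
  assumes a: "\<alpha> \<noteq> 0" and disc: "\<And>x. x\<^sup>2 \<noteq> \<beta>\<^sup>2 - 4 * \<alpha> * \<gamma>"
    and content: "\<And>d. d dvd \<alpha> \<Longrightarrow> d dvd \<beta> \<Longrightarrow> d dvd \<gamma> \<Longrightarrow> d dvd 1"
  shows "irreducible [:\<gamma>, \<beta>, \<alpha>:]"
proof (rule irreducibleI)
  show "[:\<gamma>, \<beta>, \<alpha>:] \<noteq> 0" using a by simp
  show "\<not> [:\<gamma>, \<beta>, \<alpha>:] dvd 1" using a by (simp add: is_unit_poly_iff)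
  have const: "g dvd 1" if "[:\<gamma>, \<beta>, \<alpha>:] = g * h" "degree g = 0" for g h
  proof -
    obtain d where d: "g = [:d:]" using \<open>degree g = 0\<close> by (rule degree_eq_zeroE)
    have "[:\<gamma>, \<beta>, \<alpha>:] = smult d h" using that(1) d by simp
    then have "\<alpha> = d * coeff h 2" "\<beta> = d * coeff h 1" "\<gamma> = d * coeff h 0"
      by (metis coeff_smult coeff_pCons_0 coeff_pCons_Suc numeral_2_eq_2 One_nat_def)+
    then have "d dvd 1" by (intro content) auto
    then show ?thesis by (simp only: d is_unit_const_poly_iff)
  qed
  fix g h assume gh: "[:\<gamma>, \<beta>, \<alpha>:] = g * h"
  then have "g \<noteq> 0" "h \<noteq> 0" using a by auto
  then have "degree g + degree h = 2" using arg_cong[OF gh, of degree] a by (simp add: degree_mult_eq)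
  then consider "degree g = 0" | "degree h = 0" | "degree g = 1" "degree h = 1" by linarith
  then show "g dvd 1 \<or> h dvd 1"
  proof cases
    case 1
    then show ?thesis using const[OF gh] by blast
  next
    case 2
    then show ?thesis using const[of h g] gh by (simp add: mult.commute)
  next
    case 3
    then obtain g0 g1 h0 h1 where "g = [:g0, g1:]" "h = [:h0, h1:]" by (metis degree1_coeffs)
    then have "\<gamma> = g0 * h0" "\<beta> = g0 * h1 + g1 * h0" "\<alpha> = g1 * h1" using gh by simp_all
    then have "(g0 * h1 - g1 * h0)\<^sup>2 = \<beta>\<^sup>2 - 4 * \<alpha> * \<gamma>" by (simp add: power2_eq_square algebra_simps)
    then show ?thesis using disc by blast
  qed
qed

text \<open>The local hypothesis serves twice: it makes the Gcd of the values 1, and it bounds the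
  content, since a common divisor of the coefficients divides every value.\<close>

lemma bunyakovsky_prime_value:
  fixes \<alpha> \<beta> \<gamma> :: int
  assumes B: "quadratic_bunyakovsky" and a: "\<alpha> > 0" and disc: "\<And>x. x\<^sup>2 \<noteq> \<beta>\<^sup>2 - 4 * \<alpha> * \<gamma>"
    and loc: "\<And>q. prime q \<Longrightarrow> \<exists>n::nat. n > 0 \<and> \<not> q dvd \<alpha> * (int n)\<^sup>2 + \<beta> * int n + \<gamma>"
  shows "\<exists>n. prime (\<alpha> * n\<^sup>2 + \<beta> * n + \<gamma>)"
proof -
  define f where "f = [:\<gamma>, \<beta>, \<alpha>:]"
  have pf: "poly f x = \<alpha> * x\<^sup>2 + \<beta> * x + \<gamma>" for x by (simp add: f_def power2_eq_square algebra_simps)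
  have unit: "d dvd 1" if "\<And>n::nat. n > 0 \<Longrightarrow> d dvd poly f (int n)" for d
  proof (rule ccontr)
    assume "\<not> d dvd 1"
    \<comment> \<open>This covers \<open>d = 0\<close>, which has 2 as a prime divisor.\<close>
    have "prime (2 :: int)" by simp
    then have "\<exists>q. prime q \<and> q dvd d"
      using \<open>\<not> d dvd 1\<close> prime_divisor_exists[of d] by (cases "d = 0") (use dvd_0_right in blast)+
    then show False using loc that by (metis dvd_trans pf)
  qed
  have "irreducible f" unfolding f_def
  proof (rule irreducible_quadratic)
    fix d assume "d dvd \<alpha>" "d dvd \<beta>" "d dvd \<gamma>"
    then show "d dvd 1" by (intro unit) (simp add: pf)
  qed (use a disc in auto)
  moreover have "Gcd ((\<lambda>n :: nat. poly f (int n)) ` {1..}) = 1"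
  proof -
    have "Gcd ((\<lambda>n :: nat. poly f (int n)) ` {1..}) dvd 1" by (rule unit) (auto intro: Gcd_dvd)
    then show ?thesis using Gcd_int_greater_eq_0 by (metis abs_of_nonneg zdvd1_eq)
  qed
  moreover have "degree f = 2" "lead_coeff f > 0" using a by (simp_all add: f_def)
  ultimately have "infinite {n :: nat. n > 0 \<and> prime (poly f (int n))}"
    using B unfolding quadratic_bunyakovsky_def by blast
  then have "{n :: nat. n > 0 \<and> prime (poly f (int n))} \<noteq> {}" by (metis finite.emptyI)
  then show ?thesis by (auto simp: pf)
qed

subsection \<open>Integer quadruples\<close>

text \<open>The vector \<open>e\<close> stands for the point at infinity: it is isotropic, and its
  product with \<open>co C\<close> is the curvature. Expanding \<open>bil e e = 0\<close> in
  coordinates gives the relation.\<close>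

lemma descartes_relation:
  assumes "pairwise_tangent v"
  shows "2 * (\<Sum>i\<in>UNIV. (curvature (v $ i))\<^sup>2) = (\<Sum>i\<in>UNIV. curvature (v $ i))\<^sup>2"
proof -
  define e :: quad where "e = (0, - 2, 0)"
  have k: "bil e (co C) = curvature C" for C by (simp add: e_def bil_def co_def)
  have "0 = bil (\<Sum>i\<in>UNIV. coord v i e *\<^sub>R co (v $ i)) e"
    using coord_expansion[OF assms, of e] by (simp add: e_def bil_def)
  also have "\<dots> = (\<Sum>i\<in>UNIV. (2 * curvature (v $ i) - (\<Sum>j\<in>UNIV. curvature (v $ j))) / 4 * curvature (v $ i))"
    by (simp add: bil_sum bil_scale coord_def bil_sym[of _ e] k)
  also have "\<dots> = (2 * (\<Sum>i\<in>UNIV. (curvature (v $ i))\<^sup>2) - (\<Sum>i\<in>UNIV. curvature (v $ i))\<^sup>2) / 4"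
    unfolding sum_4 power2_eq_square by (simp add: field_simps)
  finally show ?thesis by simp
qed

definition has_curvatures :: "circle ^ 4 \<Rightarrow> int \<Rightarrow> int \<Rightarrow> int \<Rightarrow> int \<Rightarrow> bool" where
  "has_curvatures v a b c d \<longleftrightarrow> curvature (v $ 1) = of_int a \<and> curvature (v $ 2) = of_int b \<and>
     curvature (v $ 3) = of_int c \<and> curvature (v $ 4) = of_int d"

lemma descartes_relation_int:
  assumes "pairwise_tangent v" "has_curvatures v a b c d"
  shows "2 * (a\<^sup>2 + b\<^sup>2 + c\<^sup>2 + d\<^sup>2) = (a + b + c + d)\<^sup>2"
proof -
  have "real_of_int (2 * (a\<^sup>2 + b\<^sup>2 + c\<^sup>2 + d\<^sup>2)) = of_int ((a + b + c + d)\<^sup>2)"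
    using descartes_relation[OF assms(1)] assms(2) by (simp add: sum_4 has_curvatures_def)
  then show ?thesis by linarith
qed

text \<open>With four odd entries the relation becomes \<open>s\<^sup>2 = 2 * T + 2\<close>, where
  \<open>T\<close> is a sum of products of consecutive integers and hence even; but no square is 2
  modulo 4.\<close>

lemma descartes_parity:
  fixes a b c d :: int
  assumes r: "2 * (a\<^sup>2 + b\<^sup>2 + c\<^sup>2 + d\<^sup>2) = (a + b + c + d)\<^sup>2" and d: "odd d"
  shows "odd a \<and> even b \<and> even c \<or> even a \<and> odd b \<and> even c \<or> even a \<and> even b \<and> odd c"
proof -
  have "even ((a + b + c + d)\<^sup>2)" by (simp flip: r)
  then have e: "even (a + b + c + d)" by simp
  have "\<not> (odd a \<and> odd b \<and> odd c)"
  proof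
    assume "odd a \<and> odd b \<and> odd c"
    then obtain x y z w where h: "a = 2 * x + 1" "b = 2 * y + 1" "c = 2 * z + 1" "d = 2 * w + 1"
      using d by (metis oddE)
    have "4 * (x + y + z + w + 2)\<^sup>2 = 8 * (x * (x + 1) + y * (y + 1) + z * (z + 1) + w * (w + 1)) + 8"
      using r by (simp add: h power2_eq_square algebra_simps)
    then have q: "(x + y + z + w + 2)\<^sup>2 = 2 * (x * (x + 1) + y * (y + 1) + z * (z + 1) + w * (w + 1)) + 2" by simp
    then have "even ((x + y + z + w + 2)\<^sup>2)" by simp
    then have "even (x + y + z + w + 2)" by simp
    then obtain u where "x + y + z + w + 2 = 2 * u" by (rule evenE)
    then have "2 * u\<^sup>2 = (x * (x + 1) + y * (y + 1) + z * (z + 1) + w * (w + 1)) + 1"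
      using q by (simp add: power2_eq_square)
    moreover have "even (2 * u\<^sup>2)" by simp
    ultimately have "even ((x * (x + 1) + y * (y + 1) + z * (z + 1) + w * (w + 1)) + 1)" by (simp only:)
    then show False by simp
  qed
  then show ?thesis using e d by auto
qed

section \<open>Curvatures along chains\<close>

text \<open>The integer version of \<open>chain\<close>, arranged by powers of \<open>k\<close> for
  use as a quadratic polynomial.\<close>

definition int_chain :: "int \<Rightarrow> int \<Rightarrow> int \<Rightarrow> int \<Rightarrow> int" where
  "int_chain S y0 y1 k = S * k\<^sup>2 + (y1 - y0 - S) * k + y0"

lemma even_int_chain:
  "even k \<Longrightarrow> even (int_chain S y0 y1 k) \<longleftrightarrow> even y0"
  "even k \<Longrightarrow> even (int_chain S y0 y1 (k + 1)) \<longleftrightarrow> even y1"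
  by (auto simp: int_chain_def)

lemma curvature_act_W:
  assumes v: "pairwise_tangent v" and ij: "i \<noteq> j" and s: "even s"
    and c: "curvature (v $ i) = of_int y0" "curvature (v $ j) = of_int y1"
      "(\<Sum>k\<in>UNIV - {i, j}. curvature (v $ k)) = of_int S"
  shows "curvature (act (W j i s) v $ i) = of_int (int_chain S y0 y1 s)"
    "curvature (act (W j i s) v $ j) = of_int (int_chain S y0 y1 (s + 1))"
proof -
  have e: "fst (\<Sum>k\<in>UNIV - {i, j}. co (v $ k)) = of_int S"
    by (simp add: fst_sum c flip: curvature_co)
  show "curvature (act (W j i s) v $ i) = of_int (int_chain S y0 y1 s)"
    "curvature (act (W j i s) v $ j) = of_int (int_chain S y0 y1 (s + 1))"
    unfolding curvature_co act_W(2,3)[OF v ij s] fst_chain e c[unfolded curvature_co]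
    by (simp_all add: chain_def int_chain_def power2_eq_square algebra_simps)
qed

lemma UNIV_4_minus: "UNIV - {1, 2 :: 4} = {3, 4}" "UNIV - {2, 3 :: 4} = {1, 4}"
  "UNIV - {3, 2 :: 4} = {1, 4}" "UNIV - {3, 4 :: 4} = {1, 2}"
  unfolding UNIV_4 by auto

lemma has_curvatures_W21:
  assumes "pairwise_tangent v" "has_curvatures v a b c d" "even t"
  shows "has_curvatures (act (W 2 1 t) v) (int_chain (c + d) a b t) (int_chain (c + d) a b (t + 1)) c d"
  using curvature_act_W[of v 1 2 t a b "c + d"] act_W(1)[of v 1 2 t] assms
  by (simp add: has_curvatures_def UNIV_4_minus)

lemma has_curvatures_W32:
  assumes "pairwise_tangent v" "has_curvatures v a b c d" "even t"
  shows "has_curvatures (act (W 3 2 t) v) a (int_chain (a + d) b c t) (int_chain (a + d) b c (t + 1)) d"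
  using curvature_act_W[of v 2 3 t b c "a + d"] act_W(1)[of v 2 3 t] assms
  by (simp add: has_curvatures_def UNIV_4_minus)

text \<open>Letting index 3 act first gives the third slot the even index of the chain, which starts
  at \<open>c\<close>.\<close>

lemma has_curvatures_W23:
  assumes "pairwise_tangent v" "has_curvatures v a b c d" "even t"
  shows "has_curvatures (act (W 2 3 t) v) a (int_chain (a + d) c b (t + 1)) (int_chain (a + d) c b t) d"
  using curvature_act_W[of v 3 2 t c b "a + d"] act_W(1)[of v 3 2 t] assms
  by (simp add: has_curvatures_def UNIV_4_minus)

lemma has_curvatures_W43:
  assumes "pairwise_tangent v" "has_curvatures v a b c d" "even t"
  shows "has_curvatures (act (W 4 3 t) v) a b (int_chain (a + b) c d t) (int_chain (a + b) c d (t + 1))"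
  using curvature_act_W[of v 3 4 t c d "a + b"] act_W(1)[of v 3 4 t] assms
  by (simp add: has_curvatures_def UNIV_4_minus)

lemma has_curvatures_ex:
  assumes "primitive_integral P" "descartes_quadruple P v"
  shows "\<exists>a b c d. has_curvatures v a b c d"
  using assms unfolding primitive_integral_def descartes_quadruple_def has_curvatures_def
  by (metis Ints_cases)

section \<open>Choosing a quadruple around a circle of prime curvature\<close>

lemma not_all_dvd:
  fixes p :: int
  assumes P: "apollonian_packing P" "primitive_integral P" and p: "prime p" "odd p"
    and v: "descartes_quadruple P v" "has_curvatures v a b c d"
  shows "\<not> (p dvd a \<and> p dvd b \<and> p dvd c \<and> p dvd d)"
proof
  assume "p dvd a \<and> p dvd b \<and> p dvd c \<and> p dvd d"
  then obtain a' b' c' d' where d: "a = p * a'" "b = p * b'" "c = p * c'" "d = p * d'" by (auto elim!: dvdE)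
  have "p dvd e" if "D \<in> P" "curvature D = of_int e" for D e
  proof -
    define f where "f i = (if i = 1 then a' else if i = 2 then b' else if i = 3 then c' else d')" for i :: 4
    have "curvature (v $ i) = of_int (p * f i)" for i
      using exhaust_4[of i] v(2) by (auto simp: has_curvatures_def d f_def)
    then have "p dvd 4 * e" using dvd_packing[OF P(1) v(1)] that by blast
    moreover have "\<not> p dvd 4" using p prime_dvd_two prime_dvd_mult_iff[of p 2 2] by auto
    ultimately show ?thesis using p by (simp add: prime_dvd_mult_iff)
  qed
  then have "p dvd Gcd {k :: int. \<exists>C\<in>P. curvature C = of_int k}" by (intro Gcd_greatest) auto
  then show False using P(2) p by (simp add: primitive_integral_def not_prime_unit)
qed

lemma descartes_quadruple_permute:
  assumes "descartes_quadruple P (quadruple A B C D)"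
  shows "descartes_quadruple P (quadruple B A C D)" "descartes_quadruple P (quadruple C B A D)"
    "descartes_quadruple P (quadruple D B C A)"
  using assms tangent_sym unfolding descartes_quadruple_def pairwise_tangent_iff forall_4 by simp_all

lemma quadruple_eta: "quadruple (v $ 1) (v $ 2) (v $ 3) (v $ 4) = v"
  by (simp add: vec_eq_iff forall_4)

text \<open>The Descartes relation leaves exactly one odd curvature besides \<open>p\<close>;
  reordering puts it first.\<close>

lemma quadruple_with_parity:
  assumes P: "apollonian_packing P" "primitive_integral P" and D: "D \<in> P" "curvature D = of_int p" "odd p"
  shows "\<exists>v a b c. descartes_quadruple P v \<and> v $ 4 = D \<and> has_curvatures v a b c p \<and> odd a \<and> even b \<and> even c"
proof -
  obtain x i where x: "descartes_quadruple P x" "x $ i = D" using in_quadruple[OF P(1) D(1)] by blast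
  have "descartes_quadruple P (quadruple (x $ 1) (x $ 2) (x $ 3) (x $ 4))" using x by (simp add: quadruple_eta)
  then obtain A B C where q: "descartes_quadruple P (quadruple A B C D)"
    using exhaust_4[of i] x(2) descartes_quadruple_permute by metis
  obtain a b c where h: "curvature A = of_int a" "curvature B = of_int b" "curvature C = of_int c"
    using has_curvatures_ex[OF P(2) q] by (auto simp: has_curvatures_def)
  have "has_curvatures (quadruple A B C D) a b c p" using h D by (simp add: has_curvatures_def)
  then have "odd a \<and> even b \<and> even c \<or> even a \<and> odd b \<and> even c \<or> even a \<and> even b \<and> odd c"
    using descartes_parity descartes_relation_int q D(3) unfolding descartes_quadruple_def by blast
  moreover have ?thesis if "descartes_quadruple P (quadruple A B C D)" "curvature A = of_int a"
      "curvature B = of_int b" "curvature C = of_int c" "odd a" "even b" "even c" for A B C a b c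
    using that D by (intro exI[of _ "quadruple A B C D"] exI[of _ a] exI[of _ b] exI[of _ c])
      (simp add: has_curvatures_def)
  ultimately show ?thesis using q h descartes_quadruple_permute by blast
qed

text \<open>Two moves: the first makes \<open>a + p\<close> prime to the obstruction
  \<open>gcd (c + p) N\<close>, after which a chain through the third slot reaches a value prime to
  all of \<open>N\<close>.\<close>

lemma quadruple_coprime:
  fixes N p :: int
  assumes P: "apollonian_packing P" "primitive_integral P" and D: "D \<in> P" "curvature D = of_int p"
    and p: "prime p" "odd p" and N: "odd N"
  shows "\<exists>v a b c. descartes_quadruple P v \<and> v $ 4 = D \<and> has_curvatures v a b c p \<and>
    odd a \<and> even b \<and> even c \<and> coprime (c + p) N"
proof -
  obtain v a b c where v: "descartes_quadruple P v" "v $ 4 = D" "has_curvatures v a b c p"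
      "odd a" "even b" "even c"
    using quadruple_with_parity[OF P D p(2)] by blast
  have pt: "pairwise_tangent v" using v(1) by (simp add: descartes_quadruple_def)
  have nd: "\<not> (q dvd a + p \<and> q dvd b + p \<and> q dvd c + p)" if q: "prime q" "odd q" for q
  proof
    assume d: "q dvd a + p \<and> q dvd b + p \<and> q dvd c + p"
    \<comment> \<open>The Descartes relation in the shifted curvatures: a common odd prime factor
      must be \<open>p\<close>, and it would then divide the whole quadruple.\<close>
    have "2 * 2 * p * p = (a + p) * (2 * (b + p) - (a + p)) + (b + p) * (2 * (c + p) - (b + p)) + (c + p) * (2 * (a + p) - (c + p))"
      using descartes_relation_int[OF pt v(3)] by (simp add: power2_eq_square algebra_simps)
    moreover have "q dvd \<dots>" using d by (blast intro: dvd_add dvd_mult2)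
    ultimately have "q dvd 2 * 2 * p * p" by (simp only:)
    moreover have "\<not> q dvd 2 * 2" using q prime_dvd_two prime_dvd_mult_iff[of q 2 2] by auto
    ultimately have "q dvd p" using q prime_dvd_mult_iff[of q] by auto
    then have "q = p" using q p primes_dvd_imp_eq by blast
    then have "p dvd a \<and> p dvd b \<and> p dvd c \<and> p dvd p" using d by (simp add: dvd_add_left_iff)
    then show False using not_all_dvd[OF P p v(1,3)] by blast
  qed
  have oddq: "odd q" if "q \<in> prime_factors n" "odd n" for q n :: int
    using that by (metis dvd_trans in_prime_factors_imp_dvd)
  define N1 where "N1 = gcd (c + p) N"
  have "N1 dvd N" by (simp add: N1_def)
  then have "odd N1" using N dvd_trans by blast
  then have "\<exists>k. even k \<and> coprime ((c + p) * k\<^sup>2 + (b - a - (c + p)) * k + (a + p)) N1"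
  proof (rule quadratic_coprime)
    fix q assume q: "q \<in> prime_factors N1"
    show "\<not> (q dvd c + p \<and> q dvd b - a - (c + p) \<and> q dvd a + p)"
    proof
      assume *: "q dvd c + p \<and> q dvd b - a - (c + p) \<and> q dvd a + p"
      then have "q dvd (b - a - (c + p)) + (c + p) + (a + p)" by (blast intro: dvd_add)
      then have "q dvd b + p" by simp
      then show False using nd[of q] * q oddq[OF q \<open>odd N1\<close>] by auto
    qed
  qed
  then obtain k where k: "even k" "coprime (int_chain (c + p) a b k + p) N1"
    by (auto simp: int_chain_def add.assoc)
  define v1 where "v1 = act (W 2 1 k) v"
  define a1 b1 where "a1 = int_chain (c + p) a b k" and "b1 = int_chain (c + p) a b (k + 1)"
  have v1: "descartes_quadruple P v1" "v1 $ 4 = D" "has_curvatures v1 a1 b1 c p" "odd a1" "even b1"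
    unfolding v1_def a1_def b1_def
    using descartes_quadruple_act[OF P(1) v(1)] act_W(1)[OF pt, of 1 2 k 4] has_curvatures_W21[OF pt v(3) k(1)]
      v k(1) even_int_chain by auto
  have pt1: "pairwise_tangent v1" using v1(1) by (simp add: descartes_quadruple_def)
  have "\<exists>r. even r \<and> coprime ((a1 + p) * r\<^sup>2 + (b1 - c - (a1 + p)) * r + (c + p)) N"
  proof (rule quadratic_coprime[OF N])
    fix q assume q: "q \<in> prime_factors N"
    show "\<not> (q dvd a1 + p \<and> q dvd b1 - c - (a1 + p) \<and> q dvd c + p)"
    proof
      assume *: "q dvd a1 + p \<and> q dvd b1 - c - (a1 + p) \<and> q dvd c + p"
      then have "q dvd N1" using q by (auto simp: N1_def)
      then have "q dvd 1" using k(2) * by (metis a1_def coprime_common_divisor)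
      then show False using q not_prime_unit by blast
    qed
  qed
  then obtain r where r: "even r" "coprime (int_chain (a1 + p) c b1 r + p) N"
    by (auto simp: int_chain_def add.assoc)
  have "descartes_quadruple P (act (W 2 3 r) v1)" "act (W 2 3 r) v1 $ 4 = D"
    using descartes_quadruple_act[OF P(1) v1(1)] act_W(1)[OF pt1, of 3 2 r 4] v1(2) r(1) by auto
  then show ?thesis
    using has_curvatures_W23[OF pt1 v1(3) r(1)] r v1(4,5) v(6) even_int_chain by blast
qed

subsection \<open>A prime circle in a prescribed residue class\<close>

text \<open>\<open>u + m * u\<close> is even because \<open>m\<close> is odd; a further even
  multiple of \<open>m\<close> secures the lower bound.\<close>

lemma even_representative:
  fixes m u :: int
  assumes "odd m" "m > 0"
  shows "\<exists>k. even k \<and> k > 2 \<and> [k = u] (mod m)"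
proof (intro exI conjI)
  let ?k = "u + m * (u + 2 * (\<bar>u\<bar> + 3))"
  show "even ?k" using assms by auto
  show "[?k = u] (mod m)" by (simp add: cong_iff_dvd_diff)
  define z where "z = u + 2 * (\<bar>u\<bar> + 3)"
  have "1 * z \<le> m * z" using assms by (intro mult_right_mono) (auto simp: z_def)
  moreover have "u + z > 2" unfolding z_def by (cases "u \<ge> 0") auto
  ultimately have "u + m * z > 2" by linarith
  then show "?k > 2" by (simp only: z_def)
qed

text \<open>The multiplicity of \<open>p\<close> would be even on the left and odd on the
  right.\<close>

lemma not_square_times_prime:
  fixes p c k :: int
  assumes p: "prime p" and c: "\<not> p dvd c" and k: "k \<noteq> 0"
  shows "x\<^sup>2 \<noteq> k\<^sup>2 * (p * c)"
proof
  assume "x\<^sup>2 = k\<^sup>2 * (p * c)"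
  moreover have nz: "c \<noteq> 0" "p \<noteq> 0" using c p by auto
  ultimately have x: "x \<noteq> 0" using k by auto
  have "multiplicity p (x\<^sup>2) = 2 * multiplicity p x"
    by (rule prime_elem_multiplicity_power_distrib) (use p x in auto)
  moreover have "multiplicity p (k\<^sup>2 * (p * c)) = 2 * multiplicity p k + (1 + multiplicity p c)"
  proof -
    have pe: "prime_elem p" using p by (rule prime_imp_prime_elem)
    have "multiplicity p (p * c) = 1 + multiplicity p c"
      using prime_elem_multiplicity_mult_distrib[OF pe nz(2,1)] multiplicity_self[of p] nz(2) p not_prime_unit
      by auto
    moreover have "multiplicity p (k\<^sup>2) = 2 * multiplicity p k"
      by (rule prime_elem_multiplicity_power_distrib[OF pe k])
    ultimately show ?thesis
      using prime_elem_multiplicity_mult_distrib[OF pe, of "k\<^sup>2" "p * c"] k nz by simp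
  qed
  moreover have "multiplicity p c = 0" using c by (simp add: not_dvd_imp_multiplicity_0)
  ultimately have "2 * multiplicity p x = 2 * multiplicity p k + 1"
    using \<open>x\<^sup>2 = k\<^sup>2 * (p * c)\<close> by simp
  then show False by presburger
qed

lemma coprime_30:
  fixes m :: int
  assumes "coprime m 30"
  shows "odd m" "\<not> 5 dvd m"
proof -
  have "coprime m 2" "coprime m 5" by (rule coprime_divisors[OF _ _ assms]; simp)+
  then show "odd m" "\<not> 5 dvd m" by (auto dest: coprime_common_divisor[of m 5 5])
qed

text \<open>Modulo a prime factor of \<open>m\<close> each element of \<open>F\<close> excludes at
  most two of the seven residues \<open>0..6\<close>, so at most six are lost.\<close>

lemma chain_avoids:
  fixes \<alpha> \<beta> \<gamma> m :: int and F :: "int set"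
  assumes m: "m > 1" "coprime m 30" and a: "coprime \<alpha> m" and F: "finite F" "card F \<le> 3"
  shows "\<exists>t. \<forall>f\<in>F. coprime (\<alpha> * t\<^sup>2 + \<beta> * t + \<gamma> + f) m"
proof -
  have "\<exists>t. \<forall>f\<in>F. \<not> q dvd \<alpha> * t\<^sup>2 + \<beta> * t + \<gamma> + f" if q: "q \<in> prime_factors m" for q
  proof -
    have pq: "prime q" "q dvd m" using q by auto
    have "\<not> q dvd 30" using m(2) pq not_prime_unit coprime_common_divisor by blast
    moreover have "\<not> q dvd 30 \<Longrightarrow> q \<ge> 7"
    proof (rule ccontr)
      assume h: "\<not> q dvd 30" "\<not> q \<ge> 7"
      then have "q \<in> {2, 3, 4, 5, 6}" using int_prime_pos[OF pq(1)] by auto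
      then show False using h(1) pq(1) by (auto simp: prime_int_numeral_eq)
    qed
    ultimately have q7: "q \<ge> 7" by blast
    have na: "\<not> q dvd \<alpha>" using a m coprime_iff_primes[of m \<alpha>] q by auto
    let ?R = "\<lambda>f. {t \<in> {0..6}. q dvd \<alpha> * t\<^sup>2 + \<beta> * t + (\<gamma> + f)}"
    have "card (\<Union>f\<in>F. ?R f) \<le> (\<Sum>f\<in>F. card (?R f))" using F(1) by (rule card_UN_le)
    also have "\<dots> \<le> (\<Sum>f\<in>F. 2)" by (intro sum_mono quadratic_roots_mod_prime pq(1) q7 na)
    also have "\<dots> < 7" using F by simp
    finally have c7: "card (\<Union>f\<in>F. ?R f) < 7" .
    have "finite (\<Union>f\<in>F. ?R f)" by (rule finite_subset[of _ "{0..6}"]) auto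
    then have "\<not> {0..6} \<subseteq> (\<Union>f\<in>F. ?R f)"
      using card_mono[of "\<Union>f\<in>F. ?R f" "{0..6 :: int}"] c7 by fastforce
    then obtain t where "t \<in> {0..6}" "t \<notin> (\<Union>f\<in>F. ?R f)" by blast
    then show ?thesis by (intro exI[of _ t]) (auto simp: add.assoc)
  qed
  then obtain u where u: "\<And>q. q \<in> prime_factors m \<Longrightarrow> \<forall>f\<in>F. \<not> q dvd \<alpha> * (u q)\<^sup>2 + \<beta> * u q + \<gamma> + f" by metis
  obtain t where t: "\<And>q. q \<in> prime_factors m \<Longrightarrow> [t = u q] (mod q)" using chinese_remainder_primes by blast
  have "\<not> q dvd \<alpha> * t\<^sup>2 + \<beta> * t + \<gamma> + f" if "q \<in> prime_factors m" "f \<in> F" for q f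
  proof -
    have "[\<alpha> * t\<^sup>2 + \<beta> * t + \<gamma> + f = \<alpha> * (u q)\<^sup>2 + \<beta> * u q + \<gamma> + f] (mod q)"
      using t[OF that(1)] by (intro cong_add cong_mult cong_pow) auto
    then show ?thesis using u that cong_dvd_iff by blast
  qed
  then show ?thesis using m coprime_iff_primes[of m] by auto
qed

text \<open>The second difference of the three values is \<open>2 * x\<close>; a first difference
  then yields \<open>y\<close>. The arguments 1, 2, 3 are positive, as the local condition
  demands.\<close>

lemma dvd_quadratic_coeffs:
  fixes q x y z :: int
  assumes q: "prime q" "odd q" and d: "q dvd x + y + z" "q dvd x * 4 + y * 2 + z" "q dvd x * 9 + y * 3 + z"
  shows "q dvd x \<and> q dvd y"
proof -
  have "q dvd (x * 9 + y * 3 + z) - (x * 4 + y * 2 + z) - ((x * 4 + y * 2 + z) - (x + y + z))"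
    by (intro dvd_diff d)
  then have "q dvd 2 * x" by (simp add: algebra_simps)
  then have x: "q dvd x" using q prime_dvd_two prime_dvd_mult_iff by blast
  have "q dvd (x * 4 + y * 2 + z) - (x + y + z) - x * 3"
    by (intro dvd_diff d dvd_mult2 x)
  then show ?thesis using x by (simp add: algebra_simps)
qed

text \<open>The conjecture is applied along \<open>t0 + 2 * m * n\<close>, where the parity and the
  residue modulo \<open>m\<close> of the chain are constant.\<close>

lemma prime_in_chain:
  fixes m p a b c :: int
  assumes B: "quadratic_bunyakovsky" and m: "m > 1" "coprime m 30"
    and p: "prime p" "odd p" and a: "odd a"
    and r: "2 * (a\<^sup>2 + b\<^sup>2 + c\<^sup>2 + p\<^sup>2) = (a + b + c + p)\<^sup>2"
    and C: "c + p > 0" "coprime (c + p) (m * p)" and F: "0 \<in> F" "finite F" "card F \<le> 3"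
  shows "\<exists>t. even t \<and> prime (int_chain (c + p) a b t) \<and> odd (int_chain (c + p) a b t) \<and>
    (\<forall>f\<in>F. coprime (int_chain (c + p) a b t + f) m)"
proof -
  define C where "C = c + p"
  define \<beta> where "\<beta> = b - a - C"
  define g where "g t = C * t\<^sup>2 + \<beta> * t + a" for t
  have odd_m: "odd m" using m(2) by (rule coprime_30)
  have "coprime C m" "coprime C p" using C(2) by (auto simp: C_def)
  have pC: "\<not> p dvd C"
  proof
    assume "p dvd C"
    then have "p dvd 1" using \<open>coprime C p\<close> coprime_common_divisor dvd_refl by blast
    then show False using p(1) not_prime_unit by blast
  qed
  then have pc: "\<not> p dvd c" by (simp add: C_def)
  have disc: "\<beta>\<^sup>2 - 4 * C * a = 4 * p * c"
    using r by (simp add: \<beta>_def C_def power2_eq_square algebra_simps)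
  obtain t1 where t1: "\<forall>f\<in>F. coprime (g t1 + f) m"
    using chain_avoids[OF m \<open>coprime C m\<close> F(2,3)] unfolding g_def by blast
  obtain t0 where t0: "even t0" "[t0 = t1] (mod m)" using even_representative[of m t1] odd_m m(1) by auto
  have good: "coprime (g (t0 + 2 * m * n) + f) m" if "f \<in> F" for n f
  proof -
    have "[2 * m * n = 0] (mod m)" by (simp add: cong_0_iff)
    then have "[t0 + 2 * m * n = t1] (mod m)" using cong_add[OF t0(2)] by fastforce
    then have "[g (t0 + 2 * m * n) + f = g t1 + f] (mod m)"
      unfolding g_def by (intro cong_add cong_mult cong_pow) auto
    then show ?thesis using t1 that cong_imp_coprime cong_sym by blast
  qed
  have oddg: "odd (g (t0 + 2 * m * n))" for n using a t0(1) by (simp add: g_def)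
  let ?\<alpha> = "4 * m\<^sup>2 * C" and ?\<beta> = "4 * m * C * t0 + 2 * m * \<beta>" and ?\<gamma> = "g t0"
  have f: "?\<alpha> * n\<^sup>2 + ?\<beta> * n + ?\<gamma> = g (t0 + 2 * m * n)" for n
    by (simp add: g_def power2_eq_square algebra_simps)
  have disc2: "?\<beta>\<^sup>2 - 4 * ?\<alpha> * ?\<gamma> = (4 * m)\<^sup>2 * (p * c)"
  proof -
    have "?\<beta>\<^sup>2 - 4 * ?\<alpha> * ?\<gamma> = 4 * m\<^sup>2 * (\<beta>\<^sup>2 - 4 * C * a)"
      by (simp add: g_def power2_eq_square algebra_simps)
    then show ?thesis unfolding disc by (simp add: power_mult_distrib)
  qed
  have "\<exists>n. prime (?\<alpha> * n\<^sup>2 + ?\<beta> * n + ?\<gamma>)"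
  proof (rule bunyakovsky_prime_value[OF B])
    show "?\<alpha> > 0" using m C(1) by (simp add: C_def)
    fix x show "x\<^sup>2 \<noteq> ?\<beta>\<^sup>2 - 4 * ?\<alpha> * ?\<gamma>"
      unfolding disc2 by (rule not_square_times_prime[OF p(1) pc]) (use m in simp)
  next
    fix q :: int assume q: "prime q"
    show "\<exists>n::nat. n > 0 \<and> \<not> q dvd ?\<alpha> * (int n)\<^sup>2 + ?\<beta> * int n + ?\<gamma>"
    proof (rule ccontr)
      assume "\<not> ?thesis"
      \<comment> \<open>The primes dividing \<open>m\<close> and the prime 2 are excluded by
        \<open>good\<close> and \<open>oddg\<close>. Any other fixed divisor divides leading
        coefficient and discriminant, hence \<open>C\<close> and \<open>p * c\<close>, hence
        \<open>p\<close>; but \<open>p\<close> does not divide \<open>C\<close>.\<close>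
      then have all: "q dvd ?\<alpha> * (int n)\<^sup>2 + ?\<beta> * int n + ?\<gamma>" if "n > 0" for n :: nat using that by blast
      have "\<not> q dvd m"
      proof
        assume "q dvd m"
        moreover have "q dvd g (t0 + 2 * m * int 1)" using all[of 1] f[of "int 1"] by simp
        ultimately have "q dvd 1" using good[OF F(1), of 1] coprime_common_divisor by fastforce
        then show False using q not_prime_unit by blast
      qed
      have "odd q"
      proof
        assume "even q"
        moreover have "q dvd g (t0 + 2 * m * int 1)" using all[of 1] f[of "int 1"] by simp
        ultimately show False using oddg[of "int 1"] dvd_trans by blast
      qed
      then have "\<not> q dvd 2" using q prime_dvd_two by blast
      then have nd: "\<not> q dvd 4" using q prime_dvd_mult_iff[of q 2 2] by auto
      have f123: "q dvd ?\<alpha> + ?\<beta> + ?\<gamma>" "q dvd ?\<alpha> * 4 + ?\<beta> * 2 + ?\<gamma>" "q dvd ?\<alpha> * 9 + ?\<beta> * 3 + ?\<gamma>"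
        using all[of 1] all[of 2] all[of 3] by simp_all
      have qa: "q dvd ?\<alpha>" and qb: "q dvd ?\<beta>" using dvd_quadratic_coeffs[OF q \<open>odd q\<close> f123] by blast+
      have "q dvd ?\<beta> * ?\<beta> - ?\<alpha> * (4 * ?\<gamma>)" by (intro dvd_diff dvd_mult2 qa qb)
      also have "?\<beta> * ?\<beta> - ?\<alpha> * (4 * ?\<gamma>) = (4 * m)\<^sup>2 * (p * c)"
        unfolding disc2[symmetric] by (simp add: power2_eq_square)
      finally have "q dvd p \<or> q dvd c"
        using q nd \<open>\<not> q dvd m\<close> by (metis prime_dvd_multD prime_dvd_power)
      moreover have "q dvd C"
        using qa q nd \<open>\<not> q dvd m\<close> by (metis prime_dvd_multD prime_dvd_power)
      ultimately have "q dvd p" by (auto simp: C_def dvd_add_right_iff)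
      then have "q = p" using q p primes_dvd_imp_eq by blast
      then show False using pC \<open>q dvd C\<close> by blast
    qed
  qed
  then obtain n where "prime (g (t0 + 2 * m * n))" unfolding f by blast
  moreover have "g t = int_chain (c + p) a b t" for t by (simp add: g_def int_chain_def \<beta>_def C_def)
  ultimately show ?thesis using good oddg t0(1) by (intro exI[of _ "t0 + 2 * m * n"]) auto
qed

text \<open>After completing the square, the summand \<open>y\<close> of a representation as two
  squares determines \<open>\<sigma> = 1 - s\<close>, and \<open>x\<close> then determines
  \<open>r\<close> by a linear congruence.\<close>

lemma circle_in_residue_class:
  fixes m l p q b c :: int
  assumes m: "m > 1" "coprime m 30"
    and rel: "2 * (q\<^sup>2 + b\<^sup>2 + c\<^sup>2 + p\<^sup>2) = (q + b + c + p)\<^sup>2"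
    and q: "coprime q m" "coprime (q + p) m" "coprime (q + l) m"
  shows "\<exists>r s. even r \<and> even s \<and> s > 2 \<and>
    [int_chain (q + int_chain (q + p) b c r) (int_chain (q + p) b c (r + 1)) p s = l] (mod m)"
proof -
  define \<alpha> h \<beta> where "\<alpha> = q + p" and "h = c - b - (q + p)" and "\<beta> = b + q"
  have rel': "4 * \<alpha> * \<beta> - h\<^sup>2 = 4 * q\<^sup>2"
    using rel by (simp add: \<alpha>_def h_def \<beta>_def power2_eq_square algebra_simps)
  have m2: "odd m" "\<not> 5 dvd m" "coprime 2 m" using coprime_30[OF m(2)] by simp_all
  have "coprime (2 * 2 * \<alpha> * (q + l)) m" using q m2(3) unfolding \<alpha>_def by (simp only: coprime_mult_left_iff)
  then have c4: "coprime (4 * \<alpha> * (q + l)) m" by simp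
  obtain x y where xy: "[x\<^sup>2 + y\<^sup>2 = 4 * \<alpha> * (q + l)] (mod m)" "coprime y m"
    using two_squares_mod[OF _ m2(1,2) c4] m by auto
  have solve: "\<exists>z. [k * z = e] (mod m)" if k: "coprime k m" for k e
  proof -
    obtain i where "[k * i = 1] (mod m)" using cong_solve_coprime_int[OF k] by blast
    then have "[k * i * e = 1 * e] (mod m)" by (intro cong_mult) auto
    then show ?thesis by (intro exI[of _ "i * e"]) (simp add: mult.assoc)
  qed
  obtain \<sigma>0 where s0: "[2 * q * \<sigma>0 = y] (mod m)" using solve[of "2 * q" y] q m2 by auto
  \<comment> \<open>The bound on \<open>s\<close> later keeps the final circle from touching
    \<open>Cp\<close>.\<close>
  obtain s where s: "even s" "s > 2" "[s = 1 - \<sigma>0] (mod m)" using even_representative[of m] m2 m by auto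
  define \<sigma> where "\<sigma> = 1 - s"
  have "[1 - s = 1 - (1 - \<sigma>0)] (mod m)" using s(3) by (intro cong_diff) auto
  then have "[2 * q * \<sigma> = 2 * q * \<sigma>0] (mod m)" unfolding \<sigma>_def by (intro cong_mult) auto
  then have sy: "[2 * q * \<sigma> = y] (mod m)" using s0 cong_trans by blast
  then have "coprime (2 * q * \<sigma>) m" using xy(2) cong_imp_coprime cong_sym by blast
  then have "coprime \<sigma> m" by simp
  \<comment> \<open>The congruence is solvable because \<open>\<sigma>\<close> inherits
    invertibility from \<open>y\<close>.\<close>
  then obtain r0 where r0: "[2 * \<alpha> * \<sigma> * r0 = x - h * \<sigma> - 2 * \<alpha>] (mod m)"
    using solve[of "2 * \<alpha> * \<sigma>"] q m2(3) unfolding \<alpha>_def coprime_mult_left_iff by blast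
  obtain r where r: "even r" "[r = r0] (mod m)" using even_representative[of m] m2 m by auto
  have "[2 * \<alpha> * \<sigma> * r = 2 * \<alpha> * \<sigma> * r0] (mod m)" using r(2) by (intro cong_mult) auto
  then have "[2 * \<alpha> * \<sigma> * r = x - h * \<sigma> - 2 * \<alpha>] (mod m)" using r0 cong_trans by blast
  then have "[2 * \<alpha> * \<sigma> * r + (h * \<sigma> + 2 * \<alpha>) = x - h * \<sigma> - 2 * \<alpha> + (h * \<sigma> + 2 * \<alpha>)] (mod m)"
    by (intro cong_add) auto
  then have rx: "[2 * \<alpha> * (1 + \<sigma> * r) + h * \<sigma> = x] (mod m)" by (simp add: algebra_simps)
  define T where "T = int_chain (q + int_chain (q + p) b c r) (int_chain (q + p) b c (r + 1)) p s"
  have T: "T + q = \<alpha> * (1 + \<sigma> * r)\<^sup>2 + h * (1 + \<sigma> * r) * \<sigma> + \<beta> * \<sigma>\<^sup>2"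
    by (simp add: T_def int_chain_def \<alpha>_def h_def \<beta>_def \<sigma>_def power2_eq_square algebra_simps)
  have "4 * \<alpha> * (T + q) = (2 * \<alpha> * (1 + \<sigma> * r) + h * \<sigma>)\<^sup>2 + (4 * \<alpha> * \<beta> - h\<^sup>2) * \<sigma>\<^sup>2"
    unfolding T by (simp add: power2_eq_square algebra_simps)
  also have "\<dots> = (2 * \<alpha> * (1 + \<sigma> * r) + h * \<sigma>)\<^sup>2 + (2 * q * \<sigma>)\<^sup>2"
    unfolding rel' by (simp add: power_mult_distrib)
  also have "[\<dots> = x\<^sup>2 + y\<^sup>2] (mod m)" by (intro cong_add cong_pow rx sy)
  finally have "[4 * \<alpha> * (T + q) = 4 * \<alpha> * (q + l)] (mod m)" using xy(1) cong_trans by blast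
  moreover have "coprime (4 * \<alpha>) m" using c4 by (rule coprime_divisors[rotated 2]) simp_all
  ultimately have "[T + q = q + l] (mod m)" by (simp add: cong_mult_lcancel)
  then have "[T = l] (mod m)" by (metis add.commute cong_add_lcancel)
  then show ?thesis using r(1) s(1,2) unfolding T_def by blast
qed

subsection \<open>Prime components\<close>

text \<open>Paths to and from \<open>D\<close> can be routed through \<open>C\<close>, so
  \<open>insert D X\<close> is connected and maximality applies.\<close>

lemma prime_component_closed:
  assumes X: "prime_component P X" "C \<in> X" and D: "D \<in> odd_prime_circles P" "tangent C D"
  shows "D \<in> X"
proof -
  have conn: "tangency_connected X" using X(1) by (simp add: prime_component_def)
  have "\<exists>cs. tangency_path (insert D X) E F cs" if EF: "E \<in> insert D X" "F \<in> insert D X" for E F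
  proof -
    have inX: "\<exists>cs. tangency_path (insert D X) E F cs" if "E \<in> X" "F \<in> X" for E F
      using conn that unfolding tangency_connected_def tangency_path_def by blast
    show ?thesis
    proof (cases "E \<in> X")
      case True
      show ?thesis
      proof (cases "F \<in> X")
        case False
        obtain cs where "tangency_path (insert D X) E C cs" using inX True X(2) by blast
        then have "tangency_path (insert D X) E D (cs @ [D])"
          using D(2) by (auto simp: tangency_path_def successively_append_iff)
        then show ?thesis using False EF by blast
      qed (use inX True in blast)
    next
      case False
      then have E: "E = D" using EF by blast
      show ?thesis
      proof (cases "F \<in> X")
        case True
        then obtain cs where "tangency_path (insert D X) C F cs" using inX X(2) by blast
        then have "tangency_path (insert D X) D F (D # cs)"
          using tangent_sym[OF D(2)] by (cases cs) (auto simp: tangency_path_def)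
        then show ?thesis using E by blast
      next
        case False
        then have "F = D" using EF by blast
        then have "tangency_path (insert D X) E F [D]" using E by (simp add: tangency_path_def)
        then show ?thesis by blast
      qed
    qed
  qed
  then have "tangency_connected (insert D X)" by (simp add: tangency_connected_def)
  moreover have "insert D X \<subseteq> odd_prime_circles P" using X(1) D(1) by (simp add: prime_component_def)
  ultimately have "insert D X = X" using X(1) unfolding prime_component_def by blast
  then show ?thesis by blast
qed

section \<open>Geodesics with two tangencies\<close>

text \<open>The set stays arbitrary because both the thickened component and the word family are
  meant.\<close>

lemma tangency_geodesic_two:
  assumes "C \<in> X" "D \<in> X" "E \<in> X" "tangent C D" "tangent D E" "C \<noteq> E" "\<not> tangent C E"
  shows "tangency_geodesic X C E [C, D, E]"
  unfolding tangency_geodesic_def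
proof (intro conjI allI impI)
  show "tangency_path X C E [C, D, E]" using assms by (simp add: tangency_path_def)
  fix ds assume ds: "tangency_path X C E ds"
  show "length [C, D, E] \<le> length ds"
  proof (rule ccontr)
    assume "\<not> ?thesis"
    then have "length ds < 3" by simp
    moreover have "ds \<noteq> []" using ds by (simp add: tangency_path_def)
    \<comment> \<open>One entry would force \<open>C = E\<close>, two would force tangency.\<close>
    ultimately consider a where "ds = [a]" | a b where "ds = [a, b]"
      by (cases ds rule: remdups_adj.cases) auto
    then show False using ds assms by cases (auto simp: tangency_path_def)
  qed
qed

text \<open>The inversive product of the circles with indices \<open>s\<close> and \<open>1\<close> of a chain is \<open>1 - 2 (s - 1)\<^sup>2\<close>.\<close>

lemma act_W43_not_tangent:
  assumes v: "pairwise_tangent v" and s: "even s" "s > 2"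
  shows "act (W 4 3 s) v $ 3 \<noteq> v $ 4" "\<not> tangent (v $ 4) (act (W 4 3 s) v $ 3)"
proof -
  let ?E = "act (W 4 3 s) v $ 3"
  have e: "co ?E = chain (\<Sum>k\<in>UNIV - {3, 4}. co (v $ k)) (co (v $ 3)) (co (v $ 4)) s"
    using act_W(2)[OF v _ s(1), of 3 4] by simp
  have "bil (co ?E) (co (v $ 4)) = 1 - 2 * (of_int s - 1)\<^sup>2"
    unfolding e bil_chain bil_sum gram[OF v] UNIV_4_minus
    by (simp add: chain_def power2_eq_square algebra_simps)
  \<comment> \<open>The product thus falls below -1, whereas equality would give 1 and tangency
    -1.\<close>
  moreover have "(of_int s - 1 :: real)\<^sup>2 > 1" using s(2) by (intro one_less_power) auto
  ultimately have "bil (co ?E) (co (v $ 4)) < - 1" by simp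
  then have "ip ?E (v $ 4) < - 1" by (simp add: ip_co)
  moreover have "ip (v $ 4) (v $ 4) = 1" using gram[OF v, of 4 4] by (simp add: ip_co)
  ultimately show "?E \<noteq> v $ 4" "\<not> tangent (v $ 4) ?E"
    using tangent_imp[of "v $ 4" ?E] ip_sym[of "v $ 4" ?E] by auto
qed

theorem theorem6p2p5:
  fixes m l p :: int and P X :: "circle set" and Cp :: circle
  assumes "quadratic_bunyakovsky"
    and "m > 1" and "coprime m 30"
    and "apollonian_packing P" and "primitive_integral P"
    and "prime p" and "odd p"
    and "Cp \<in> P" and "curvature Cp = of_int p"
    and "prime_component P X" and "Cp \<in> X"
  shows "\<exists>Cl. at_tangency_distance (thickening P X) 2 Cp Cl \<and>
     (\<exists>k :: int. curvature Cl = of_int k \<and> [k = l] (mod m)) \<and>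
     (\<exists>path v. tangency_path (thickening P X) Cp Cl path \<and> length path = 3 \<and>
        descartes_quadruple P v \<and> v $ 4 = Cp \<and>
        (\<exists>c :: int. curvature (v $ 3) = of_int c \<and> gcd (c + p) m = 1) \<and>
        (\<exists>s0 r0 t :: int. word_geodesic (W 4 3 s0 @ W 3 2 r0 @ W 2 1 t) v Cp Cl path))"
proof -
  note P = assms(4,5) and p = assms(6,7) and m = assms(2,3)
  have "odd m" using m(2) by (rule coprime_30)
  \<comment> \<open>The factor \<open>p\<close> of the modulus keeps \<open>p\<close> from dividing
    \<open>c\<close>, so that the discriminant of the first chain is not a square.\<close>
  then obtain v a b c where v: "descartes_quadruple P v" "v $ 4 = Cp" "has_curvatures v a b c p"
    and par: "odd a" "even b" "even c" and cop: "coprime (c + p) (m * p)"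
    using quadruple_coprime[OF P assms(8,9) p, of "m * p"] p(2) by auto
  have pt: "pairwise_tangent v" using v(1) by (simp add: descartes_quadruple_def)
  \<comment> \<open>Besides a positive sum, \<open>future\<close> only allows both curvatures to
    vanish, which \<open>p\<close> does not.\<close>
  have "future (v $ 3) (v $ 4)" using pt tangent_imp by (simp add: pairwise_tangent_def)
  then have pos: "c + p > 0"
    using v(3) p(1) not_prime_0 by (auto simp: future_def has_curvatures_def simp flip: of_int_add)
  have card: "card {0, p, l} \<le> 3" by (simp add: card_insert_if)
  \<comment> \<open>The offsets \<open>0\<close>, \<open>p\<close>, \<open>l\<close> are the three
    unit conditions of \<open>circle_in_residue_class\<close>.\<close>
  obtain t where t: "even t" "prime (int_chain (c + p) a b t)" "odd (int_chain (c + p) a b t)"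
    "\<forall>f\<in>{0, p, l}. coprime (int_chain (c + p) a b t + f) m"
    using prime_in_chain[OF assms(1) m p par(1) descartes_relation_int[OF pt v(3)] pos cop, of "{0, p, l}"] card
    by auto
  define q b1 where "q = int_chain (c + p) a b t" and "b1 = int_chain (c + p) a b (t + 1)"
  define v1 where "v1 = act (W 2 1 t) v"
  have v1: "descartes_quadruple P v1" "pairwise_tangent v1" "v1 $ 4 = Cp" "has_curvatures v1 q b1 c p"
    using descartes_quadruple_act[OF P(1) v(1)] pairwise_tangent_act[OF pt] act_W(1)[OF pt, of 1 2 t 4]
      has_curvatures_W21[OF pt v(3) t(1)] v(2) t(1)
    by (auto simp: v1_def q_def b1_def)
  obtain r s where rs: "even r" "even s" "s > 2"
    "[int_chain (q + int_chain (q + p) b1 c r) (int_chain (q + p) b1 c (r + 1)) p s = l] (mod m)"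
    using circle_in_residue_class[OF m descartes_relation_int[OF v1(2,4)], of l] t(4) unfolding q_def by auto
  define v2 where "v2 = act (W 3 2 r) v1"
  have v2: "descartes_quadruple P v2" "pairwise_tangent v2" "v2 $ 4 = Cp" "v2 $ 1 = v1 $ 1"
    "has_curvatures v2 q (int_chain (q + p) b1 c r) (int_chain (q + p) b1 c (r + 1)) p"
    using descartes_quadruple_act[OF P(1) v1(1)] pairwise_tangent_act[OF v1(2)]
      act_W(1)[OF v1(2), of 2 3 r 4] act_W(1)[OF v1(2), of 2 3 r 1]
      has_curvatures_W32[OF v1(2,4) rs(1)] v1(3) rs(1)
    by (auto simp: v2_def)
  define v3 where "v3 = act (W 4 3 s) v2"
  have v3: "descartes_quadruple P v3" "pairwise_tangent v3" "v3 $ 1 = v1 $ 1"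
    using descartes_quadruple_act[OF P(1) v2(1)] pairwise_tangent_act[OF v2(2)] act_W(1)[OF v2(2), of 3 4 s 1] v2(4) rs(2)
    by (auto simp: v3_def)
  \<comment> \<open>The last two factors leave slot 1 alone, so \<open>Cq\<close> occurs together
    with \<open>Cp\<close> in \<open>v1\<close> and with \<open>Cl\<close> in
    \<open>v3\<close>.\<close>
  define Cq Cl where "Cq = v1 $ 1" and "Cl = v3 $ 3"
  have far: "Cp \<noteq> Cl" "\<not> tangent Cp Cl"
    using act_W43_not_tangent[OF v2(2) rs(2,3)] v2(3) by (auto simp: v3_def Cl_def)
  have tan: "tangent Cp Cq" "tangent Cq Cl"
    using v1(2,3) v3(2,3) tangent_sym by (auto simp: pairwise_tangent_iff Cq_def Cl_def)
  have "Cq \<in> odd_prime_circles P"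
    using v1(1,4) t(2,3) by (auto simp: odd_prime_circles_def Cq_def descartes_quadruple_def has_curvatures_def q_def)
  then have CqX: "Cq \<in> X" using prime_component_closed[OF assms(10,11)] tan(1) by blast
  have "Cl \<in> P" using v3(1) by (simp add: descartes_quadruple_def Cl_def)
  then have thick: "Cp \<in> thickening P X" "Cq \<in> thickening P X" "Cl \<in> thickening P X"
    using assms(11) CqX tangent_sym[OF tan(2)] by (auto simp: thickening_def)
  let ?w = "W 4 3 s @ W 3 2 r @ W 2 1 t"
  \<comment> \<open>The three circles appear after the factor \<open>W 2 1 t\<close>, the empty word
    and the whole word, respectively.\<close>
  have "act (W 2 1 t) v $ 1 \<in> word_family ((W 4 3 s @ W 3 2 r) @ W 2 1 t) v"
    "act [] v $ 4 \<in> word_family (?w @ []) v" "act ?w v $ 3 \<in> word_family ([] @ ?w) v"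
    by (rule word_family_suffix)+
  then have fam: "Cp \<in> word_family ?w v" "Cq \<in> word_family ?w v" "Cl \<in> word_family ?w v"
    using v(2) by (simp_all add: Cq_def Cl_def v1_def v2_def v3_def)
  have geo: "tangency_geodesic (thickening P X) Cp Cl [Cp, Cq, Cl]"
    "tangency_geodesic (word_family ?w v) Cp Cl [Cp, Cq, Cl]"
    using thick fam tan far by (auto intro: tangency_geodesic_two)
  have res: "\<exists>k :: int. curvature Cl = of_int k \<and> [k = l] (mod m)"
    using has_curvatures_W43[OF v2(2,5) rs(2)] rs(4) unfolding Cl_def v3_def has_curvatures_def by blast
  have wg: "word_geodesic ?w v Cp Cl [Cp, Cq, Cl]"
    using geo(2) v(2) by (auto simp: word_geodesic_def)
  have gc: "\<exists>c :: int. curvature (v $ 3) = of_int c \<and> gcd (c + p) m = 1"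
    using v(3) cop by (auto simp: has_curvatures_def coprime_iff_gcd_eq_1[symmetric])
  have dist: "at_tangency_distance (thickening P X) 2 Cp Cl"
    unfolding at_tangency_distance_def using geo(1) by (intro exI[of _ "[Cp, Cq, Cl]"]) simp
  have path: "tangency_path (thickening P X) Cp Cl [Cp, Cq, Cl]"
    using geo(1) by (simp add: tangency_geodesic_def)
  have ww: "\<exists>s0 r0 t :: int. word_geodesic (W 4 3 s0 @ W 3 2 r0 @ W 2 1 t) v Cp Cl [Cp, Cq, Cl]"
    using wg by blast
  show ?thesis
    by (rule exI[of _ Cl], intro conjI dist res, rule exI[of _ "[Cp, Cq, Cl]"], rule exI[of _ v],
        intro conjI path v(1,2) gc ww) simp
qed

end
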